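(* Let $p\ge2$ and $k\ge1$. The natural inclusion $i:F(p^k)\to F(p)$ is a quasi-isometric embedding with respect to the word metrics of $F(p^k)$ and $F(p)$.
   Context: For $q\ge2$, $F(q)$ is the group of piecewise-linear orientation-preserving homeomorphisms of $[0,1]$ with breakpoints in $\mathbb{Z}[1/q]$ and slopes integer powers of $q$; it is generated by the finite set $x_0,\dots,x_{q-1}$ from the presentation $\langle x_0,x_1,\dots\mid x_i^{-1}x_jx_i=x_{j+q-1}\ (i<j)\rangle$, and its word metric is taken with respect to these generators. Since $\mathbb{Z}[1/p^k]=\mathbb{Z}[1/p]$ and powers of $p^k$ are powers of $p$, $F(p^k)$ is a subgroup of $F(p)$; $i$ is this inclusion. A map $f$ between metric spaces is a quasi-isometric embedding if there are constants $C\ge1$, $K\ge0$ with $\frac1C d(a,b)-K\le d(f(a),f(b))\le C d(a,b)+K$ for all $a,b$. *)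

theory Defs
  imports Complex_Main
begin

definition Zinv :: "nat \<Rightarrow> real set" where
  "Zinv q = {x. \<exists>(a::int) (n::nat). x = real_of_int a / (real q) ^ n}"

definition Fgrp :: "nat \<Rightarrow> (real \<Rightarrow> real) set" where
  "Fgrp q = {f. (\<forall>t. t \<notin> {0..1} \<longrightarrow> f t = t)
     \<and> f ` {0..1} = {0..1} \<and> strict_mono_on {0..1} f \<and> continuous_on {0..1} f
     \<and> (\<exists>xs :: real list. sorted_wrt (<) xs \<and> xs \<noteq> [] \<and> hd xs = 0 \<and> last xs = 1
          \<and> set xs \<subseteq> Zinv q
          \<and> (\<forall>j. Suc j < length xs \<longrightarrow>
               (\<exists>(m::int) (c::real). \<forall>t\<in>{xs ! j .. xs ! Suc j}. f t = (real q) powi m * t + c)))}"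

text \<open>The generator x_r of F(q) for r \<le> q-2: identity on [0,r/q], and on [r/q,1]
  it moves the caret hanging from the last child of the root to child r.\<close>
definition xgen_low :: "nat \<Rightarrow> nat \<Rightarrow> real \<Rightarrow> real" where
  "xgen_low q r t = (let Q = real q; R = real r in
     if t \<le> R / Q then t
     else if t \<le> (Q - 1) / Q then R / Q + (t - R / Q) / Q
     else if t \<le> (Q - 1) / Q + (R + 1) / Q^2 then t - (Q - 1 - R) * (Q - 1) / Q^2
     else if t \<le> 1 then Q * t - (Q - 1)
     else t)"

definition xgen :: "nat \<Rightarrow> nat \<Rightarrow> real \<Rightarrow> real" where
  "xgen q i = (if i + 1 < q then xgen_low q i
     else (\<lambda>t. let Q = real q in
             if (Q - 1) / Q \<le> t \<and> t \<le> 1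
             then (Q - 1) / Q + xgen_low q 0 (Q * t - (Q - 1)) / Q
             else t))"

definition letter :: "nat \<Rightarrow> nat \<times> bool \<Rightarrow> real \<Rightarrow> real" where
  "letter q l = (if snd l then xgen q (fst l) else inv (xgen q (fst l)))"

definition eval_word :: "nat \<Rightarrow> (nat \<times> bool) list \<Rightarrow> real \<Rightarrow> real" where
  "eval_word q w = foldr (\<lambda>l g. letter q l \<circ> g) w id"

definition word_length :: "nat \<Rightarrow> (real \<Rightarrow> real) \<Rightarrow> nat" where
  "word_length q g = (LEAST n. \<exists>w. length w = n \<and> (\<forall>l\<in>set w. fst l < q) \<and> eval_word q w = g)"

definition word_dist :: "nat \<Rightarrow> (real \<Rightarrow> real) \<Rightarrow> (real \<Rightarrow> real) \<Rightarrow> real" where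
  "word_dist q a b = real (word_length q (inv a \<circ> b))"

end

theory Submission
  imports Defs
begin

text \<open>
  Call a standard \<open>q\<close>-adic interval bad for \<open>f\<close> if \<open>f\<close> does not map it affinely onto a standard
  \<open>q\<close>-adic interval. The word length of \<open>f\<close> in \<open>F(q)\<close> is comparable to the number of intervals that
  are bad for \<open>f\<close> plus the number of those that are bad for the inverse of \<open>f\<close>.

  The number of bad intervals of a product is at most the sum of those of the factors, which bounds
  it by a multiple of the word length. Conversely, let \<open>f\<close> have \<open>n\<close> bad intervals. As long as some
  leaf of the right spine is bad for \<open>f\<close>, multiply \<open>f\<close> on the right by the generator of the infinite
  presentation that splits the leftmost such leaf; each step removes a bad interval off the spine.
  The indices that occur never decrease and are at most linear in \<open>n\<close>, so their product \<open>u\<close> has length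
  linear in \<open>n\<close> in the finite generators. Treating the inverse of \<open>f u\<close> in the same way ends with a
  map that permutes the leaves of the spine, hence with the identity.

  For \<open>f\<close> in \<open>F(p^k)\<close>, the intervals that are bad in base \<open>p^k\<close> are exactly the bad intervals in base
  \<open>p\<close> whose depth is a multiple of \<open>k\<close>. So there are at most as many in base \<open>p^k\<close> as in base \<open>p\<close>.
\<close>

text \<open>A pair \<open>J = (a, d)\<close> stands for the interval \<open>[a / q ^ d, (a + 1) / q ^ d]\<close>, and \<open>pt q J\<close> is its affine
  parametrisation by \<open>[0, 1]\<close>.\<close>
definition pt :: "nat \<Rightarrow> nat \<times> nat \<Rightarrow> real \<Rightarrow> real" where
  "pt q J t = (real (fst J) + t) / real q ^ snd J"

definition std_cell :: "nat \<Rightarrow> nat \<times> nat \<Rightarrow> bool" where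
  "std_cell q J \<longleftrightarrow> fst J < q ^ snd J"

text \<open>The cells that do not contain the point 1, that is, that are off the right spine.\<close>
definition inner_cell :: "nat \<Rightarrow> nat \<times> nat \<Rightarrow> bool" where
  "inner_cell q J \<longleftrightarrow> fst J + 1 < q ^ snd J"

definition subcell :: "nat \<Rightarrow> nat \<times> nat \<Rightarrow> nat \<Rightarrow> nat \<Rightarrow> nat \<times> nat" where
  "subcell q J n c = (fst J * q ^ n + c, snd J + n)"

definition cell_map :: "nat \<Rightarrow> (real \<Rightarrow> real) \<Rightarrow> nat \<times> nat \<Rightarrow> nat \<times> nat \<Rightarrow> bool" where
  "cell_map q f J K \<longleftrightarrow> (\<forall>t\<in>{0..1}. f (pt q J t) = pt q K t)"

definition good :: "nat \<Rightarrow> (real \<Rightarrow> real) \<Rightarrow> nat \<times> nat \<Rightarrow> bool" where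
  "good q f J \<longleftrightarrow> (\<exists>K. cell_map q f J K)"

text \<open>For an element of \<open>F(q)\<close> these are the carets of the source tree of its reduced tree diagram.\<close>
definition bad_cells :: "nat \<Rightarrow> (real \<Rightarrow> real) \<Rightarrow> (nat \<times> nat) set" where
  "bad_cells q f = {J. std_cell q J \<and> \<not> good q f J}"

text \<open>Maps are total on the reals and fixed outside the unit interval, as in
  \<open>Fgrp\<close>, so that \<open>inv\<close> is a two-sided inverse. Continuity follows from
  strict monotonicity and surjectivity.\<close>

definition homeo01 :: "(real \<Rightarrow> real) \<Rightarrow> bool" where
  "homeo01 f \<longleftrightarrow> strict_mono f \<and> surj f \<and> (\<forall>t. t \<le> 0 \<or> 1 \<le> t \<longrightarrow> f t = t)"

text \<open>The tree diagram view of F(q), with a complete source tree of depth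
  \<open>N\<close>.\<close>

definition tame_homeos :: "nat \<Rightarrow> (real \<Rightarrow> real) set" where
  "tame_homeos q = {f. homeo01 f \<and> (\<exists>N. \<forall>a<q ^ N. good q f (a, N))}"

definition width :: "nat \<Rightarrow> nat" where
  "width q = q - 1"

text \<open>The leaves, from left to right, of the infinite tree that consists of the right spine only;
  each caret of the spine contributes \<open>width q\<close> of them.\<close>
definition leaf :: "nat \<Rightarrow> nat \<Rightarrow> nat \<times> nat" where
  "leaf q j = (q ^ (j div width q + 1) - q + j mod width q, j div width q + 1)"

text \<open>This is the action on the leaves of the generator \<open>x\<^sub>i\<close> of the infinite presentation.\<close>
definition splits_leaf :: "nat \<Rightarrow> (real \<Rightarrow> real) \<Rightarrow> nat \<Rightarrow> bool" where
  "splits_leaf q x i \<longleftrightarrow> (\<forall>j<i. cell_map q x (leaf q j) (leaf q j))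
     \<and> (\<forall>k<q. cell_map q x (leaf q (i + k)) (subcell q (leaf q i) 1 k))
     \<and> (\<forall>j>i. cell_map q x (leaf q (j + width q)) (leaf q j))"

text \<open>The generator \<open>x\<^sub>i\<close> of the infinite presentation, as a conjugate by a power of \<open>x\<^sub>0\<close> of one of the
  finitely many generators; for \<open>i = 0\<close> the truncated subtraction gives \<open>c = 0\<close>.\<close>
definition xi :: "nat \<Rightarrow> nat \<Rightarrow> real \<Rightarrow> real" where
  "xi q i = (let c = (i - 1) div width q in
     (inv (xgen q 0) ^^ c) \<circ> xgen q (i - c * width q) \<circ> (xgen q 0 ^^ c))"

definition xi_prod :: "nat \<Rightarrow> nat list \<Rightarrow> real \<Rightarrow> real" where
  "xi_prod q L = foldr (\<lambda>i g. xi q i \<circ> g) L id"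

text \<open>Measures the progress of straightening. Spine cells are left out because a generator
  need not be good on them, whereas it carries each inner cell onto an inner cell.\<close>

definition inner_bad :: "nat \<Rightarrow> (real \<Rightarrow> real) \<Rightarrow> (nat \<times> nat) set" where
  "inner_bad q f = {J \<in> bad_cells q f. inner_cell q J}"

text \<open>A \<open>LEAST\<close> over an empty set is unspecified, so a bound on
  \<open>word_length\<close> alone says little; membership in a ball also certifies that
  \<open>g\<close> is a product of generators.\<close>

definition word_ball :: "nat \<Rightarrow> nat \<Rightarrow> (real \<Rightarrow> real) \<Rightarrow> bool" where
  "word_ball q n g \<longleftrightarrow> (\<exists>w. length w \<le> n \<and> (\<forall>l\<in>set w. fst l < q) \<and> eval_word q w = g)"

text \<open>For positive \<open>q\<close> this is membership in \<open>Zinv q\<close>. Quantifying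
  over all large \<open>N\<close> lets finitely many such numbers share one denominator.\<close>

definition ev_int :: "nat \<Rightarrow> real \<Rightarrow> bool" where
  "ev_int q x \<longleftrightarrow> (\<forall>\<^sub>F N in sequentially. x * real q ^ N \<in> \<int>)"

section \<open>Homeomorphisms of the line supported in the unit interval\<close>

lemma homeo01_bij: "homeo01 f \<Longrightarrow> bij f"
  by (simp add: homeo01_def bij_def strict_mono_imp_inj_on)

lemma homeo01_id: "homeo01 id"
  by (simp add: homeo01_def strict_mono_def)

lemma homeo01_comp: "homeo01 f \<Longrightarrow> homeo01 g \<Longrightarrow> homeo01 (f \<circ> g)"
  by (simp add: homeo01_def strict_mono_o comp_surj del: o_apply) (simp add: comp_def)

lemma homeo01_inv:
  assumes "homeo01 f" shows "homeo01 (inv f)"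
proof -
  have b: "bij f" using assms by (rule homeo01_bij)
  have "strict_mono (inv f)"
    using assms b by (metis homeo01_def strict_mono_inv bij_is_inj bij_is_surj inv_f_f)
  moreover have "surj (inv f)" using b by (simp add: bij_imp_bij_inv bij_is_surj)
  moreover have "inv f t = t" if "t \<le> 0 \<or> 1 \<le> t" for t
    using assms b that by (metis homeo01_def bij_is_inj inv_f_f)
  ultimately show ?thesis by (simp add: homeo01_def)
qed

lemma homeo01_less_1: "homeo01 f \<Longrightarrow> t < 1 \<Longrightarrow> f t < 1"
  unfolding homeo01_def strict_mono_def by (metis order_refl)

lemma homeo01_le_1: "homeo01 f \<Longrightarrow> t \<le> 1 \<Longrightarrow> f t \<le> 1"
  using homeo01_less_1[of f t] by (cases "t = 1") (auto simp: homeo01_def)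

lemma homeo01_ge_0: "homeo01 f \<Longrightarrow> 0 \<le> t \<Longrightarrow> 0 \<le> f t"
  unfolding homeo01_def by (metis order_refl strict_mono_less_eq)

lemma homeo01I_continuous:
  fixes f :: "real \<Rightarrow> real"
  assumes mono: "strict_mono f" and cont: "\<And>t. isCont f t"
    and out: "\<And>t. t \<le> 0 \<or> 1 \<le> t \<Longrightarrow> f t = t"
  shows "homeo01 f"
proof -
  have "\<exists>t. f t = y" for y
  proof (cases "y \<le> 0 \<or> 1 \<le> y")
    case True
    then show ?thesis using out by blast
  next
    case False
    have "f 0 = 0" "f 1 = 1" using out by auto
    then have "\<exists>x\<ge>0. x \<le> 1 \<and> f x = y"
      using False cont by (intro IVT) auto
    then show ?thesis by blast
  qed
  then have "surj f" by (metis surj_def)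
  then show ?thesis using mono out by (simp add: homeo01_def)
qed

lemma cell_map_comp:
  "cell_map q g J K \<Longrightarrow> cell_map q f K L \<Longrightarrow> cell_map q (f \<circ> g) J L"
  by (simp add: cell_map_def)

lemma cell_map_inv: "homeo01 f \<Longrightarrow> cell_map q f J K \<Longrightarrow> cell_map q (inv f) K J"
  unfolding cell_map_def by (metis homeo01_bij bij_inv_eq_iff)

section \<open>Products of generators and balls in the word metric\<close>

lemma xi_prod_simps [simp]: "xi_prod q [] = id" "xi_prod q (i # L) = xi q i \<circ> xi_prod q L"
  by (simp_all add: xi_prod_def)

lemma eval_word_simps [simp]:
  "eval_word q [] = id" "eval_word q (l # w) = letter q l \<circ> eval_word q w"
  by (simp_all add: eval_word_def)

lemma eval_word_append: "eval_word q (u @ v) = eval_word q u \<circ> eval_word q v"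
  by (induction u) (simp_all add: comp_assoc)

lemma word_ball_mono: "word_ball q m g \<Longrightarrow> m \<le> n \<Longrightarrow> word_ball q n g"
  unfolding word_ball_def by (elim exE conjE) (metis order_trans)

lemma word_ball_comp:
  assumes "word_ball q m g" "word_ball q n h" shows "word_ball q (m + n) (g \<circ> h)"
proof -
  obtain u v where "length u \<le> m" "\<forall>l\<in>set u. fst l < q" "eval_word q u = g"
    "length v \<le> n" "\<forall>l\<in>set v. fst l < q" "eval_word q v = h"
    using assms unfolding word_ball_def by blast
  then show ?thesis
    unfolding word_ball_def by (intro exI[of _ "u @ v"]) (auto simp: eval_word_append)
qed

lemma word_ball_letter: "i < q \<Longrightarrow> word_ball q 1 (letter q (i, b))"
  unfolding word_ball_def by (intro exI[of _ "[(i, b)]"]) simp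

lemma word_ball_funpow: "word_ball q 1 g \<Longrightarrow> word_ball q n (g ^^ n)"
proof (induction n)
  case 0
  then show ?case unfolding word_ball_def by (intro exI[of _ "[]"]) simp
next
  case (Suc n)
  have "word_ball q (1 + n) (g \<circ> g ^^ n)" using Suc by (intro word_ball_comp) auto
  then show ?case by (simp del: o_apply)
qed

lemma funpow_inv_cancel:
  fixes f :: "'a \<Rightarrow> 'a"
  shows "surj f \<Longrightarrow> f ^^ n \<circ> inv f ^^ n = id"
proof (induction n)
  case (Suc n)
  have "f ^^ Suc n \<circ> inv f ^^ Suc n = f ^^ n \<circ> (f \<circ> inv f) \<circ> inv f ^^ n"
    unfolding funpow_Suc_right[of n f] funpow.simps(2)[of n "inv f"] by (simp only: comp_assoc)
  also have "\<dots> = id"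
    using Suc unfolding Suc.prems[unfolded surj_iff] by (simp only: comp_id)
  finally show ?case .
qed simp

lemma subcell_subcell:
  "subcell q (subcell q J m b) n c = subcell q J (m + n) (b * q ^ n + c)"
  by (simp add: subcell_def algebra_simps power_add)

lemma inner_imp_std: "inner_cell q J \<Longrightarrow> std_cell q J"
  by (simp add: inner_cell_def std_cell_def)

lemma good_comp: "good q g J \<Longrightarrow> cell_map q g J K \<Longrightarrow> good q f K \<Longrightarrow> good q (f \<circ> g) J"
  unfolding good_def using cell_map_comp by blast

lemma good_inv_image: "homeo01 f \<Longrightarrow> cell_map q f J K \<Longrightarrow> good q (inv f) K"
  unfolding good_def using cell_map_inv by blast

lemma tame_homeos_id: "id \<in> tame_homeos q" and bad_cells_id: "bad_cells q id = {}"
proof -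
  have "good q id J" for J unfolding good_def cell_map_def by (intro exI[of _ J]) simp
  then show "id \<in> tame_homeos q" "bad_cells q id = {}"
    using homeo01_id by (simp_all add: tame_homeos_def bad_cells_def del: id_apply)
qed

text \<open>Serves to build a piecewise affine map from left to right, one piece of positive slope
  at a time.\<close>

lemma affine_extension:
  fixes f :: "real \<Rightarrow> real"
  assumes "strict_mono_on {..a} f \<and> continuous_on {..a} f"
    and f: "\<And>t. a \<le> t \<Longrightarrow> t \<le> b \<Longrightarrow> f t = m * t + c" and "0 < m" "a \<le> b"
  shows "strict_mono_on {..b} f \<and> continuous_on {..b} f"
proof
  have m: "f x < f y" if "x < y" "y \<le> a" for x y
    using assms(1) that strict_mono_onD[of "{..a}" f x y] by simp
  show "strict_mono_on {..b} f"
  proof (rule strict_mono_onI)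
    fix x y assume xy: "x \<in> {..b}" "y \<in> {..b}" "x < y"
    consider "y \<le> a" | "a \<le> x" | "x < a" "a < y" by linarith
    then show "f x < f y"
    proof cases
      case 1
      then show ?thesis using m xy by blast
    next
      case 2
      then show ?thesis using f[of x] f[of y] xy \<open>0 < m\<close> by simp
    next
      case 3
      have "f x < f a" using 3 m by blast
      also have "\<dots> < f y" using 3 f[of a] f[of y] xy \<open>0 < m\<close> \<open>a \<le> b\<close> by simp
      finally show ?thesis .
    qed
  qed
  have "continuous_on {a..b} (\<lambda>t. m * t + c)" by (intro continuous_intros)
  then have "continuous_on {a..b} f" using f by (subst continuous_on_cong[OF refl]) auto
  then have "continuous_on ({..a} \<union> {a..b}) f"
    using assms(1) by (intro continuous_on_closed_Un) auto
  moreover have "{..a} \<union> {a..b} = {..b}" using \<open>a \<le> b\<close> by auto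
  ultimately show "continuous_on {..b} f" by simp
qed

section \<open>Cells in a fixed base\<close>

context
  fixes q :: nat
  assumes q2: "2 \<le> q"
begin

lemma q_pos [simp]: "0 < q" "q \<noteq> 0" "Suc 0 \<le> q" "Suc 0 < q" "0 < width q" "width q \<noteq> 0"
  using q2 by (auto simp: width_def)

lemma pt_subcell: "pt q (subcell q J n c) t = pt q J ((real c + t) / real q ^ n)"
  using q2 by (simp add: pt_def subcell_def field_simps power_add)

lemma cell_map_subcell:
  assumes "cell_map q f J K" "c < q ^ n"
  shows "cell_map q f (subcell q J n c) (subcell q K n c)"
proof -
  have "(real c + t) / real q ^ n \<in> {0..1}" if "t \<in> {0..1}" for t
  proof -
    have "real c + 1 \<le> real (q ^ n)" using assms(2) by linarith
    then show ?thesis using that q2 by (simp add: field_simps)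
  qed
  then show ?thesis using assms(1) unfolding cell_map_def by (simp add: pt_subcell)
qed

lemma good_subcell: "good q f J \<Longrightarrow> c < q ^ n \<Longrightarrow> good q f (subcell q J n c)"
  unfolding good_def using cell_map_subcell by blast

lemma subcell_index_less: "b < q ^ m \<Longrightarrow> c < q ^ n \<Longrightarrow> b * q ^ n + c < q ^ (m + n)"
proof -
  assume a: "b < q ^ m" "c < q ^ n"
  have "b * q ^ n + c < (b + 1) * q ^ n" using a by simp
  also have "\<dots> \<le> q ^ m * q ^ n" using a by (intro mult_right_mono) auto
  finally show ?thesis by (simp add: power_add)
qed

lemma std_cell_iff: "std_cell q J \<longleftrightarrow> pt q J 1 \<le> 1"
proof -
  have "pt q J 1 \<le> 1 \<longleftrightarrow> real (fst J + 1) \<le> real (q ^ snd J)"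
    using q2 by (simp add: pt_def field_simps)
  then show ?thesis unfolding std_cell_def of_nat_le_iff by auto
qed

lemma inner_cell_iff: "inner_cell q J \<longleftrightarrow> pt q J 1 < 1"
proof -
  have "pt q J 1 < 1 \<longleftrightarrow> real (fst J + 1) < real (q ^ snd J)"
    using q2 by (simp add: pt_def field_simps)
  then show ?thesis unfolding inner_cell_def of_nat_less_iff by auto
qed

text \<open>The length of a cell determines its depth because \<open>q\<close> exceeds 1, and the
  left endpoint then determines the index.\<close>

lemma pt_inj:
  assumes "pt q J 0 = pt q K 0" "pt q J 1 = pt q K 1"
  shows "J = K"
proof -
  have "1 / real q ^ snd J = 1 / real q ^ snd K"
    using assms by (simp add: pt_def add_divide_distrib)
  then have "real q ^ snd J = real q ^ snd K" by simp
  then have "snd J = snd K" using q2 power_inject_exp[of "real q"] by auto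
  then have "fst J = fst K" using assms(1) by (simp add: pt_def)
  then show ?thesis using \<open>snd J = snd K\<close> by (simp add: prod_eq_iff)
qed

lemma cell_map_std: "homeo01 f \<Longrightarrow> std_cell q J \<Longrightarrow> cell_map q f J K \<Longrightarrow> std_cell q K"
  using homeo01_le_1[of f "pt q J 1"] by (simp add: std_cell_iff cell_map_def)

lemma cell_map_inner: "homeo01 f \<Longrightarrow> inner_cell q J \<Longrightarrow> cell_map q f J K \<Longrightarrow> inner_cell q K"
  using homeo01_less_1[of f "pt q J 1"] by (simp add: inner_cell_iff cell_map_def)

lemma cell_map_unique: "cell_map q f J K \<Longrightarrow> cell_map q f J L \<Longrightarrow> K = L"
  by (rule pt_inj) (auto simp: cell_map_def)

lemma cell_map_inject:
  assumes "homeo01 f" "cell_map q f J K" "cell_map q f I K" shows "J = I"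
  using assms cell_map_inv cell_map_unique by blast

lemma good_deeper:
  assumes "\<forall>a<q ^ N. good q f (a, N)" "std_cell q J" "N \<le> snd J"
  shows "good q f J"
proof -
  obtain a d where J: "J = (a, d)" by fastforce
  define n where "n = d - N"
  have d: "d = N + n" using assms(3) J n_def by simp
  have a: "a < q ^ N * q ^ n" using assms(2) J d by (simp add: std_cell_def power_add)
  have "J = subcell q (a div q ^ n, N) n (a mod q ^ n)" by (simp add: J d subcell_def div_mult_mod_eq)
  moreover have "a div q ^ n < q ^ N" using a by (simp add: less_mult_imp_div_less)
  ultimately show ?thesis using assms(1) by (simp add: good_subcell)
qed

text \<open>Goodness passes to subcells, so the bad cells form a subtree of the tree of all cells;
  one level without bad cells confines it to smaller depths.\<close>

lemma finite_bad_cells_iff: "finite (bad_cells q f) \<longleftrightarrow> (\<exists>N. \<forall>a<q ^ N. good q f (a, N))"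
proof
  assume fin: "finite (bad_cells q f)"
  \<comment> \<open>\<open>insert 0\<close> keeps the maximum defined when there are no bad
    cells.\<close>
  define N where "N = Suc (Max (insert 0 (snd ` bad_cells q f)))"
  have "good q f (a, N)" if "a < q ^ N" for a
  proof (rule ccontr)
    assume "\<not> good q f (a, N)"
    then have "(a, N) \<in> bad_cells q f" using that by (simp add: bad_cells_def std_cell_def)
    then have "N \<in> insert 0 (snd ` bad_cells q f)" by force
    then have "N \<le> Max (insert 0 (snd ` bad_cells q f))" using fin by (intro Max_ge) auto
    then show False by (simp add: N_def)
  qed
  then show "\<exists>N. \<forall>a<q ^ N. good q f (a, N)" by blast
next
  assume "\<exists>N. \<forall>a<q ^ N. good q f (a, N)"
  then obtain N where N: "\<forall>a<q ^ N. good q f (a, N)" ..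
  have "bad_cells q f \<subseteq> {..q ^ N} \<times> {..N}"
  proof
    fix J assume J: "J \<in> bad_cells q f"
    then have "snd J < N" using good_deeper[OF N] by (simp add: bad_cells_def) (meson not_le)
    moreover have "fst J < q ^ snd J" using J by (simp add: bad_cells_def std_cell_def)
    moreover have qN: "q ^ snd J \<le> q ^ N" using \<open>snd J < N\<close> by (intro power_increasing) auto
    ultimately have "fst J \<le> q ^ N" "snd J \<le> N" by linarith+
    then show "J \<in> {..q ^ N} \<times> {..N}" by (simp add: mem_Times_iff)
  qed
  then show "finite (bad_cells q f)" by (rule finite_subset) auto
qed

section \<open>Products and inverses of tame homeomorphisms\<close>

lemma tame_homeos_iff: "f \<in> tame_homeos q \<longleftrightarrow> homeo01 f \<and> finite (bad_cells q f)"
  by (simp add: tame_homeos_def finite_bad_cells_iff)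

text \<open>A cell that is bad for the composite is bad for the first map, or its image is a cell
  that is bad for the second one.\<close>
lemma bad_cells_comp:
  assumes "f \<in> tame_homeos q" "g \<in> tame_homeos q"
  shows "f \<circ> g \<in> tame_homeos q"
    and "card (bad_cells q (f \<circ> g)) \<le> card (bad_cells q f) + card (bad_cells q g)"
proof -
  have h: "homeo01 f" "homeo01 g" and fin: "finite (bad_cells q f)" "finite (bad_cells q g)"
    using assms by (auto simp: tame_homeos_iff)
  define im where "im J = (SOME K. cell_map q g J K)" for J
  have im: "cell_map q g J (im J)" if "good q g J" for J
    using that unfolding good_def im_def by (rule someI_ex)
  define S where "S = bad_cells q (f \<circ> g) - bad_cells q g"
  have S: "std_cell q J \<and> good q g J \<and> \<not> good q (f \<circ> g) J" if "J \<in> S" for J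
    using that by (auto simp: S_def bad_cells_def)
  have inj: "inj_on im S"
    by (rule inj_onI) (metis S im cell_map_inject h(2))
  have sub: "im ` S \<subseteq> bad_cells q f"
  proof
    fix K assume "K \<in> im ` S"
    then obtain J where J: "J \<in> S" "K = im J" by blast
    have "cell_map q g J K" using J S im by blast
    then show "K \<in> bad_cells q f"
      using S[OF J(1)] good_comp cell_map_std[OF h(2)] unfolding bad_cells_def by blast
  qed
  have finS: "finite S" using inj sub fin(1) finite_imageD finite_subset by blast
  have cS: "card S \<le> card (bad_cells q f)" using inj sub fin(1) by (meson card_inj_on_le)
  have U: "bad_cells q (f \<circ> g) \<subseteq> S \<union> bad_cells q g" by (auto simp: S_def)
  then have "finite (bad_cells q (f \<circ> g))" using finS fin(2) finite_subset by blast
  then show "f \<circ> g \<in> tame_homeos q" using h by (simp add: tame_homeos_iff homeo01_comp)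
  have "card (bad_cells q (f \<circ> g)) \<le> card (S \<union> bad_cells q g)"
    using U finS fin(2) by (intro card_mono) auto
  also have "\<dots> \<le> card S + card (bad_cells q g)" by (rule card_Un_le)
  finally show "card (bad_cells q (f \<circ> g)) \<le> card (bad_cells q f) + card (bad_cells q g)"
    using cS by simp
qed

text \<open>The images of the cells of depth \<open>N\<close> tile the unit interval. Every cell as
  deep as the deepest of them lies inside a single tile, on which the inverse is affine.\<close>

lemma tame_homeos_inv:
  assumes "f \<in> tame_homeos q" shows "inv f \<in> tame_homeos q"
proof -
  obtain N where h: "homeo01 f" and N: "\<forall>a<q ^ N. good q f (a, N)"
    using assms by (auto simp: tame_homeos_def)
  obtain im where im: "\<And>a. a < q ^ N \<Longrightarrow> cell_map q f (a, N) (im a)"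
    using N unfolding good_def by metis
  define M where "M = Max ((\<lambda>a. snd (im a)) ` {..<q ^ N})"
  have "good q (inv f) (c, M)" if c: "c < q ^ M" for c
  proof -
    \<comment> \<open>The midpoint is not an endpoint of any cell of depth at most \<open>M\<close>,
      so the tile that contains it contains the whole cell \<open>(c, M)\<close>.\<close>
    define y where "y = pt q (c, M) (1/2)"
    have c1: "real c + 1 \<le> real q ^ M" using c of_nat_mono[of "c+1" "q^M", where 'a = real] by simp
    have y: "0 < y" "y < 1" using c1 q2 by (auto simp: y_def pt_def field_simps)
    define x where "x = inv f y"
    have fx: "f x = y" using h homeo01_bij unfolding x_def by (metis bij_inv_eq_iff)
    have x: "0 \<le> x" "x < 1"
      unfolding x_def using y homeo01_inv[OF h] homeo01_ge_0 homeo01_less_1 by (auto simp: less_imp_le)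
    define a where "a = nat \<lfloor>x * real q ^ N\<rfloor>"
    define t where "t = x * real q ^ N - real a"
    have x0: "0 \<le> x * real q ^ N" using x by simp
    have ra: "real a = of_int \<lfloor>x * real q ^ N\<rfloor>" using x0 by (simp add: a_def)
    have t: "0 \<le> t" "t < 1" unfolding t_def ra by linarith+
    have xt: "x = pt q (a, N) t" using q2 by (simp add: pt_def t_def)
    have "0 < real q ^ N" using q2 by simp
    then have "x * real q ^ N < real q ^ N" using x mult_strict_right_mono[of x 1] by simp
    then have "real a < real q ^ N" using t t_def by linarith
    then have "real a < real (q ^ N)" by simp
    then have aN: "a < q ^ N" by (simp only: of_nat_less_iff)
    obtain b e where be: "im a = (b, e)" by fastforce
    have "e \<le> M" unfolding M_def using aN be by (intro Max_ge) (auto intro!: image_eqI[of _ _ a])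
    define n where "n = M - e"
    have M: "M = e + n" using \<open>e \<le> M\<close> n_def by simp
    have cm: "cell_map q f (a, N) (b, e)" using im[OF aN] be by simp
    then have "y = pt q (b, e) t" using fx xt t by (simp add: cell_map_def)
    then have "(real c + 1/2) / (real q ^ e * real q ^ n) = (real b + t) / real q ^ e"
      by (simp add: y_def pt_def M power_add)
    moreover have "u = v * P" if "u / (E * P) = v / E" "0 < E" "0 < P" for u v E P :: real
      using that by (simp add: field_simps)
    ultimately have eq: "real c + 1/2 = (real b + t) * real q ^ n" using q2 by simp
    have qn: "1 \<le> real q ^ n" using q2 by simp
    have tq: "0 \<le> t * real q ^ n" "t * real q ^ n < real q ^ n" using t q2 by simp_all
    have "real (b * q ^ n) < real (c + 1)" using eq tq by (simp add: algebra_simps)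
    then have "b * q ^ n < c + 1" by (simp only: of_nat_less_iff)
    then have lo: "b * q ^ n \<le> c" by simp
    have "real c < real b * real q ^ n + real q ^ n" using eq tq unfolding distrib_right by linarith
    then have "real c < real (b * q ^ n + q ^ n)" by simp
    then have hi: "c < b * q ^ n + q ^ n" by (simp only: of_nat_less_iff)
    have "(c, M) = subcell q (b, e) n (c - b * q ^ n)" using lo by (simp add: subcell_def M)
    then show ?thesis
      using good_subcell[OF good_inv_image[OF h cm]] lo hi by simp
  qed
  then show ?thesis using homeo01_inv[OF h] by (auto simp: tame_homeos_def)
qed

lemma real_width: "real (width q) = real q - 1"
  using q2 by (auto simp: width_def)

lemma q_eq_width: "q = Suc (width q)"
  using q2 by (auto simp: width_def)

subsection \<open>Leaves of the right spine\<close>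

lemma pt_leaf_low: "j < width q \<Longrightarrow> pt q (leaf q j) t = (real j + t) / real q"
  by (simp add: pt_def leaf_def)

text \<open>The spine is self-similar: the affine map onto the last child of the root moves every
  leaf one caret further.\<close>

lemma pt_leaf_shift: "pt q (leaf q (j + width q)) t = (real q - 1 + pt q (leaf q j) t) / real q"
proof -
  define d r where "d = j div width q" and "r = j mod width q"
  have *: "(j + width q) div width q = d + 1" "(j + width q) mod width q = r"
    using q2 by (auto simp: d_def r_def)
  have r: "real (q ^ (n + 1) - q + m) = real q * real q ^ n - real q + real m" for n m
  proof -
    have "q \<le> q ^ (n + 1)" using q2 by (simp add: mult_le_cancel1)
    then show ?thesis unfolding of_nat_add by (subst of_nat_diff) auto
  qed
  have "pt q (leaf q (j + width q)) t
      = (real q * real q ^ (d + 1) - real q + real r + t) / real q ^ (d + 2)"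
    unfolding pt_def leaf_def fst_conv snd_conv * r by simp
  moreover have "pt q (leaf q j) t = (real q * real q ^ d - real q + real r + t) / real q ^ (d + 1)"
    unfolding pt_def leaf_def fst_conv snd_conv d_def[symmetric] r_def[symmetric] r by simp
  moreover have "(Q * E * Q - Q + u) / (Q * (Q * E)) = (Q - 1 + (Q * E - Q + u) / (Q * E)) / Q"
    if "0 < Q" "0 < E" for Q E u :: real
    using that by (simp add: field_simps)
  from this[of "real q" "real q ^ d" "real r + t"]
  have "(real q * real q ^ (d + 1) - real q + real r + t) / real q ^ (d + 2)
      = (real q - 1 + (real q * real q ^ d - real q + real r + t) / real q ^ (d + 1)) / real q"
    using q2 by (simp add: algebra_simps)
  ultimately show ?thesis by simp
qed

lemma leaf_induct [case_names low shift]: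
  assumes "\<And>j. j < width q \<Longrightarrow> P j" "\<And>j. P j \<Longrightarrow> P (j + width q)"
  shows "P j"
proof (induction j rule: less_induct)
  case (less j)
  show ?case
  proof (cases "j < width q")
    case False
    then have "j - width q < j" using q_pos(5) by linarith
    then have "P (j - width q)" by (rule less)
    from assms(2)[OF this] show ?thesis using False by simp
  qed (rule assms)
qed

lemma pt_leaf_0_0: "pt q (leaf q 0) 0 = 0"
  using pt_leaf_low[of 0 0] q2 by simp

lemma pt_leaf_next: "pt q (leaf q j) 1 = pt q (leaf q (Suc j)) 0"
proof (induction j rule: leaf_induct)
  case (low j)
  show ?case
  proof (cases "Suc j < width q")
    case True
    then show ?thesis by (simp add: pt_leaf_low)
  next
    case False
    then have "Suc j = 0 + width q" using low by simp
    then have "pt q (leaf q (Suc j)) 0 = (real q - 1) / real q"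
      by (simp only: pt_leaf_shift pt_leaf_0_0) simp
    moreover have "real j + 1 = real q - 1"
      using low False by (simp flip: real_width add: of_nat_Suc[symmetric] del: of_nat_Suc)
    ultimately show ?thesis using low by (simp add: pt_leaf_low)
  qed
next
  case (shift j)
  have *: "Suc (j + width q) = Suc j + width q" by simp
  show ?case unfolding * pt_leaf_shift shift ..
qed

lemma inner_leaf: "inner_cell q (leaf q j)"
proof (induction j rule: leaf_induct)
  case (low j)
  have "real (j + 1) < real q" using low q_eq_width by (subst of_nat_less_iff) linarith
  then show ?case using low by (simp add: inner_cell_iff pt_leaf_low)
next
  case (shift j)
  then show ?case using q2 by (simp add: inner_cell_iff pt_leaf_shift)
qed

lemma pt_less: "s < t \<Longrightarrow> pt q J s < pt q J t"
  using q2 by (simp add: pt_def divide_strict_right_mono)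

lemma strict_mono_leaf: "strict_mono (\<lambda>j. pt q (leaf q j) 0)"
  unfolding strict_mono_Suc_iff using pt_less[of 0 1] by (simp flip: pt_leaf_next)

lemma leaf_eq_iff: "pt q (leaf q i) 0 = pt q (leaf q j) 0 \<longleftrightarrow> i = j"
  using strict_mono_leaf strict_mono_eq by fastforce

lemma leaf_cover:
  assumes "0 \<le> x" "x < 1"
  shows "\<exists>j. \<exists>t\<in>{0..1}. x = pt q (leaf q j) t"
proof -
  \<comment> \<open>The leaves of the first \<open>n\<close> carets leave uncovered only the last
    cell of depth \<open>n\<close>, so these points tend to 1.\<close>
  have L: "pt q (leaf q (n * width q)) 0 = 1 - 1 / real q ^ n" for n
  proof (induction n)
    case 0
    then show ?case by (simp add: pt_leaf_0_0)
  next
    case (Suc n)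
    have "Suc n * width q = n * width q + width q" by simp
    then show ?case using Suc q2 by (simp only: pt_leaf_shift) (simp add: field_simps)
  qed
  obtain n where "1 / (1 - x) < real q ^ n"
    using real_arch_pow[of "real q"] q2 by auto
  then have "x < pt q (leaf q (n * width q)) 0"
    using assms q2 unfolding L by (simp add: field_simps)
  then have ex: "\<exists>j. x < pt q (leaf q j) 0" ..
  define j where "j = (LEAST j. x < pt q (leaf q j) 0)"
  have j: "x < pt q (leaf q j) 0" unfolding j_def using ex by (rule LeastI_ex)
  then have "j \<noteq> 0" using assms pt_leaf_0_0 by (metis not_le)
  then obtain i where i: "j = Suc i" using not0_implies_Suc by blast
  have lo: "pt q (leaf q i) 0 \<le> x" using not_less_Least[of i] i by (metis j_def lessI not_le)
  have hi: "x \<le> pt q (leaf q i) 1" using j i pt_leaf_next by simp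
  define t where "t = x * real q ^ snd (leaf q i) - real (fst (leaf q i))"
  have "x = pt q (leaf q i) t" using q2 by (simp add: pt_def t_def)
  moreover have "0 \<le> t" "t \<le> 1" using lo hi q2 by (auto simp: t_def pt_def field_simps)
  ultimately show ?thesis by (intro exI[of _ i] bexI[of _ t]) auto
qed

lemma inner_cell_in_leaf:
  assumes "inner_cell q J"
  shows "\<exists>j n c. c < q ^ n \<and> J = subcell q (leaf q j) n c"
proof -
  have "a + 1 < q ^ d \<Longrightarrow> \<exists>j n c. c < q ^ n \<and> (a, d) = subcell q (leaf q j) n c" for a d
  proof (induction d arbitrary: a)
    case 0
    then show ?case by simp
  next
    case (Suc d)
    define b r where "b = a div q" and "r = a mod q"
    have a: "a = b * q + r" and r: "r < q" by (auto simp: b_def r_def)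
    have "b < q ^ d" using Suc.prems unfolding b_def
      by (simp add: less_mult_imp_div_less mult.commute)
    show ?case
    proof (cases "b + 1 < q ^ d")
      case True
      from Suc.IH[OF this] obtain j n c where c: "c < q ^ n" "(b, d) = subcell q (leaf q j) n c"
        by blast
      have "(a, Suc d) = subcell q (b, d) 1 r" by (simp add: subcell_def a)
      also have "\<dots> = subcell q (leaf q j) (n + 1) (c * q ^ 1 + r)"
        unfolding c(2) by (rule subcell_subcell)
      finally have "(a, Suc d) = subcell q (leaf q j) (n + 1) (c * q ^ 1 + r)" .
      moreover have "c * q ^ 1 + r < q ^ (n + 1)"
        using subcell_index_less[OF c(1), of r 1] r by simp
      ultimately show ?thesis by blast
    next
      case False
      \<comment> \<open>The parent lies on the spine, so the cell is itself a leaf; it is not the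
        last child because it is inner.\<close>
      then have b: "b + 1 = q ^ d" using \<open>b < q ^ d\<close> by simp
      have "a + q = q ^ Suc d + r" unfolding a power_Suc b[symmetric] by (simp add: algebra_simps)
      then have a': "a = q ^ Suc d - q + r" and "r < width q"
        using Suc.prems by (auto simp: width_def)
      then have "(a, Suc d) = leaf q (d * width q + r)" by (simp add: leaf_def)
      then have "0 < q ^ 0 \<and> (a, Suc d) = subcell q (leaf q (d * width q + r)) 0 0"
        by (simp add: subcell_def)
      then show ?thesis by blast
    qed
  qed
  from this[of "fst J" "snd J"] show ?thesis using assms by (simp add: inner_cell_def)
qed

lemma inner_subcell: "inner_cell q J \<Longrightarrow> c < q ^ n \<Longrightarrow> inner_cell q (subcell q J n c)"
  using subcell_index_less[of "fst J + 1" "snd J" 0 n]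
  by (simp add: inner_cell_def subcell_def algebra_simps)

text \<open>The parent of a leaf lies on the spine, whereas the parent of a proper subcell of a leaf
  is still inside that leaf and hence inner.\<close>

lemma subcell_eq_leafD:
  assumes "subcell q (leaf q j) n c = leaf q i" "c < q ^ n"
  shows "n = 0" "c = 0" "j = i"
proof -
  show n: "n = 0"
  proof (rule ccontr)
    assume "n \<noteq> 0"
    then obtain m where m: "n = Suc m" using not0_implies_Suc by blast
    have c: "c div q < q ^ m" using assms(2) m by (simp add: less_mult_imp_div_less mult.commute)
    define d where "d = i div width q"
    have r: "i mod width q < q"
      using mod_less_divisor[of "width q" i] q_eq_width q_pos(5) by linarith
    have "fst (leaf q i) = q ^ (d + 1) - q + i mod width q" by (simp add: leaf_def d_def)
    also have "q ^ (d + 1) - q = (q ^ d - 1) * q" by (simp add: diff_mult_distrib2 mult.commute)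
    finally have "fst (leaf q i) = (q ^ d - 1) * q + i mod width q" .
    then have "fst (leaf q i) div q = q ^ d - 1" using r by simp
    moreover have "fst (leaf q i) div q = fst (leaf q j) * q ^ m + c div q"
      unfolding assms(1)[symmetric] by (simp add: subcell_def m mult.left_commute)
    moreover have "snd (leaf q j) + m = d"
      using arg_cong[OF assms(1), of snd] by (simp add: subcell_def m d_def) (simp add: leaf_def)
    ultimately have "\<not> inner_cell q (subcell q (leaf q j) m (c div q))"
      by (simp add: subcell_def inner_cell_def)
    then show False using inner_subcell[OF inner_leaf c] by blast
  qed
  show "c = 0" using n assms(2) by simp
  then have "leaf q j = leaf q i" using n assms(1) by (simp add: subcell_def)
  then show "j = i" using leaf_eq_iff by metis
qed

subsection \<open>The generators\<close>

text \<open>All ranges are closed, unlike those of the nested conditionals in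
  \<open>xgen_low\<close>: neighbouring formulas agree at the breakpoints, by \<open>e2\<close> and
  \<open>e3\<close> where this takes a computation.\<close>

lemma xgen_low_pieces:
  assumes "r < width q"
  shows "t \<le> real r / real q \<Longrightarrow> xgen_low q r t = t"
    and "real r / real q \<le> t \<Longrightarrow> t \<le> (real q - 1) / real q \<Longrightarrow>
      xgen_low q r t = real r / real q + (t - real r / real q) / real q"
    and "(real q - 1) / real q \<le> t \<Longrightarrow> t \<le> (real q - 1) / real q + (real r + 1) / real q ^ 2 \<Longrightarrow>
      xgen_low q r t = t - (real q - 1 - real r) * (real q - 1) / real q ^ 2"
    and "(real q - 1) / real q + (real r + 1) / real q ^ 2 \<le> t \<Longrightarrow> t \<le> 1 \<Longrightarrow>
      xgen_low q r t = real q * t - (real q - 1)"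
    and "1 \<le> t \<Longrightarrow> xgen_low q r t = t"
    and "real r / real q < (real q - 1) / real q"
    and "(real q - 1) / real q + (real r + 1) / real q ^ 2 < 1"
proof -
  define Q R where "Q = real q" and "R = real r"
  have Q: "2 \<le> Q" using q2 by (simp add: Q_def)
  have "real (r + 1) < real q" using assms q_eq_width by (subst of_nat_less_iff) linarith
  then have RQ: "0 \<le> R" "R + 1 < Q" by (auto simp: Q_def R_def)
  have b1: "R / Q < (Q - 1) / Q" using RQ Q by (simp add: divide_strict_right_mono)
  have b2: "(Q - 1) / Q < (Q - 1) / Q + (R + 1) / Q ^ 2" using RQ Q by simp
  have b3: "(Q - 1) / Q + (R + 1) / Q ^ 2 < 1"
    using mult_strict_left_mono[OF RQ(2), of Q] Q by (simp add: field_simps power2_eq_square)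
  show "real r / real q < (real q - 1) / real q" using b1 by (simp add: Q_def R_def)
  show "(real q - 1) / real q + (real r + 1) / real q ^ 2 < 1" using b3 by (simp add: Q_def R_def)
  have e2: "R / Q + ((Q - 1) / Q - R / Q) / Q = (Q - 1) / Q - (Q - 1 - R) * (Q - 1) / Q ^ 2"
    using Q by (simp add: field_simps power2_eq_square)
  have e3: "(Q - 1) / Q + (R + 1) / Q ^ 2 - (Q - 1 - R) * (Q - 1) / Q ^ 2
      = Q * ((Q - 1) / Q + (R + 1) / Q ^ 2) - (Q - 1)"
    using Q by (simp add: field_simps power2_eq_square)
  note d = xgen_low_def Let_def Q_def[symmetric] R_def[symmetric]
  show "t \<le> real r / real q \<Longrightarrow> xgen_low q r t = t" by (simp add: d)
  show "real r / real q \<le> t \<Longrightarrow> t \<le> (real q - 1) / real q \<Longrightarrow>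
      xgen_low q r t = real r / real q + (t - real r / real q) / real q"
    by (simp add: d)
  show "(real q - 1) / real q \<le> t \<Longrightarrow> t \<le> (real q - 1) / real q + (real r + 1) / real q ^ 2 \<Longrightarrow>
      xgen_low q r t = t - (real q - 1 - real r) * (real q - 1) / real q ^ 2"
    unfolding d using b1 e2 by (cases "t = (Q - 1) / Q") auto
  show "(real q - 1) / real q + (real r + 1) / real q ^ 2 \<le> t \<Longrightarrow> t \<le> 1 \<Longrightarrow>
      xgen_low q r t = real q * t - (real q - 1)"
    unfolding d using b1 b2 e3 by (cases "t = (Q - 1) / Q + (R + 1) / Q ^ 2") auto
  show "1 \<le> t \<Longrightarrow> xgen_low q r t = t"
    unfolding d using b1 b2 b3 by (cases "t = 1") auto
qed

lemma homeo01_xgen_low: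
  assumes "r < width q" shows "homeo01 (xgen_low q r)"
proof (rule homeo01I_continuous)
  note pieces = xgen_low_pieces[OF assms]
  define Q R where "Q = real q" and "R = real r"
  define a b c where "a = R / Q" and "b = (Q - 1) / Q" and "c = (Q - 1) / Q + (R + 1) / Q ^ 2"
  define P where "P t \<longleftrightarrow> strict_mono_on {..t} (xgen_low q r) \<and> continuous_on {..t} (xgen_low q r)" for t
  have Q: "2 \<le> Q" using q2 by (simp add: Q_def)
  have R0: "0 \<le> R" by (simp add: R_def)
  have ab: "0 \<le> a" "a < b" "b < c" "c < 1"
    using pieces(6,7) Q R0 by (auto simp: a_def b_def c_def Q_def R_def)
  note pcs = pieces(1-5)[folded Q_def R_def, folded c_def, folded a_def b_def]
  have "continuous_on {..a} (xgen_low q r)"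
    using pcs(1) continuous_on_id by (subst continuous_on_cong[OF refl]) auto
  then have "P a" unfolding P_def using pcs(1) by (auto intro!: strict_mono_onI)
  then have "P b" unfolding P_def
    by (rule affine_extension[of _ _ _ "1 / Q" "a - a / Q"])
      (use pcs(2) Q ab in \<open>auto simp: diff_divide_distrib\<close>)
  then have "P c" unfolding P_def
    by (rule affine_extension[of _ _ _ 1 "- ((Q - 1 - R) * (Q - 1) / Q ^ 2)"])
      (use pcs(3) ab in auto)
  then have "P 1" unfolding P_def
    by (rule affine_extension[of _ _ _ Q "- (Q - 1)"]) (use pcs(4) Q ab in auto)
  then have P: "P t" if "1 \<le> t" for t unfolding P_def
    by (rule affine_extension[of _ _ _ 1 0]) (use pcs(5) that in auto)
  show "strict_mono (xgen_low q r)"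
  proof (rule strict_monoI)
    fix x y :: real assume "x < y"
    moreover have "P (max 1 y)" by (rule P) simp
    ultimately show "xgen_low q r x < xgen_low q r y"
      unfolding P_def using strict_mono_onD[of "{..max 1 y}" "xgen_low q r" x y] by simp
  qed
  show "isCont (xgen_low q r) t" for t
  proof -
    have "P (max 1 (t + 1))" by (rule P) simp
    then have "continuous_on {..<t + 1} (xgen_low q r)"
      unfolding P_def by (auto elim: continuous_on_subset)
    then show ?thesis by (simp add: continuous_on_eq_continuous_at)
  qed
  show "xgen_low q r t = t" if "t \<le> 0 \<or> 1 \<le> t" for t
    using that pcs(1,5) ab by auto
qed

lemma xgen_low_eq: "i < width q \<Longrightarrow> xgen q i = xgen_low q i"
  using q_eq_width by (auto simp: xgen_def)

text \<open>The case distinction in \<open>xgen\<close> disappears because \<open>xgen q 0\<close>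
  is the identity outside the unit interval.\<close>

lemma xgen_last:
  "xgen q (width q) t = (real q - 1 + xgen q 0 (real q * t - (real q - 1))) / real q"
proof -
  have x0: "xgen q 0 = xgen_low q 0" by (rule xgen_low_eq) simp
  have e: "xgen q (width q) t = (if (real q - 1) / real q \<le> t \<and> t \<le> 1
      then (real q - 1) / real q + xgen_low q 0 (real q * t - (real q - 1)) / real q else t)"
    using q_eq_width by (simp add: xgen_def Let_def)
  show ?thesis
  proof (cases "(real q - 1) / real q \<le> t \<and> t \<le> 1")
    case True
    then show ?thesis unfolding e x0 by (simp add: add_divide_distrib)
  next
    case False
    then have "real q * t - (real q - 1) \<le> 0 \<or> 1 \<le> real q * t - (real q - 1)"
      using q2 by (auto simp: field_simps)
    then have "xgen_low q 0 (real q * t - (real q - 1)) = real q * t - (real q - 1)"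
      using homeo01_xgen_low[of 0] by (auto simp: homeo01_def)
    then show ?thesis unfolding e x0 if_not_P[OF False] using q2 by simp
  qed
qed

lemma homeo01_xgen:
  assumes "i < q" shows "homeo01 (xgen q i)"
proof (cases "i < width q")
  case True
  then show ?thesis by (simp add: xgen_low_eq homeo01_xgen_low)
next
  case False
  then have i: "i = width q" using assms q_eq_width by linarith
  have h0: "homeo01 (xgen q 0)" by (simp add: xgen_low_eq homeo01_xgen_low)
  have m: "strict_mono (xgen q i)"
  proof (rule strict_monoI)
    fix s t :: real assume "s < t"
    then have "xgen q 0 (real q * s - (real q - 1)) < xgen q 0 (real q * t - (real q - 1))"
      using h0 q2 by (simp add: homeo01_def strict_mono_less)
    then show "xgen q i s < xgen q i t"
      using q2 by (simp add: i xgen_last divide_strict_right_mono)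
  qed
  have "surj (xgen q i)"
  proof (rule surjI)
    fix y
    define z where "z = inv (xgen q 0) (real q * y - (real q - 1))"
    have "xgen q 0 z = real q * y - (real q - 1)"
      using homeo01_bij[OF h0] unfolding z_def by (metis bij_inv_eq_iff)
    then show "xgen q i ((real q - 1 + inv (xgen q 0) (real q * y - (real q - 1))) / real q) = y"
      using q2 by (simp add: i xgen_last z_def[symmetric])
  qed
  moreover have "xgen q i t = t" if "t \<le> 0 \<or> 1 \<le> t" for t
  proof -
    have "real q * t - (real q - 1) \<le> 0 \<or> 1 \<le> real q * t - (real q - 1)"
    proof (cases "t \<le> 0")
      case True
      then have "real q * t \<le> 0" by (simp add: mult_nonneg_nonpos)
      then show ?thesis using q2 by simp
    next
      case False
      then show ?thesis using that q2 by simp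
    qed
    then have "xgen q 0 (real q * t - (real q - 1)) = real q * t - (real q - 1)"
      using h0 by (auto simp: homeo01_def)
    then show ?thesis by (simp add: i xgen_last)
  qed
  ultimately show ?thesis using m by (auto simp: homeo01_def)
qed

text \<open>The contracting piece sends the leaves from \<open>r\<close> on in the first caret to
  the first \<open>q - 1 - r\<close> children of leaf \<open>r\<close>; the translation sends the
  leaves 0 to \<open>r\<close> of the second caret to the other \<open>r + 1\<close> children. The
  expanding piece inverts the shift of \<open>pt_leaf_shift\<close>.\<close>

lemma splits_leaf_xgen_low:
  assumes r: "r < width q" shows "splits_leaf q (xgen_low q r) r"
proof -
  note pieces = xgen_low_pieces[OF r] and low = pt_leaf_low and shift = pt_leaf_shift
  define Q R where "Q = real q" and "R = real r"
  note pcs = pieces[folded Q_def R_def]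
  have Q: "2 \<le> Q" using q2 by (simp add: Q_def)
  have lt: "real j + 1 \<le> Q - 1" if "j < width q" for j
    using that real_width Q_def by linarith
  have cm1: "cell_map q (xgen_low q r) (leaf q j) (leaf q j)" if "j < r" for j
    unfolding cell_map_def
  proof
    fix t :: real assume t: "t \<in> {0..1}"
    have "(real j + t) / Q \<le> R / Q"
      using that t Q by (intro divide_right_mono) (auto simp: R_def)
    then show "xgen_low q r (pt q (leaf q j) t) = pt q (leaf q j) t"
      using that r pcs(1) by (simp add: low Q_def)
  qed
  have cm2: "cell_map q (xgen_low q r) (leaf q (r + k)) (subcell q (leaf q r) 1 k)" if "k < q" for k
    unfolding cell_map_def
  proof
    fix t :: real assume t: "t \<in> {0..1}"
    have rhs: "pt q (subcell q (leaf q r) 1 k) t = (R + (real k + t) / Q) / Q"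
      by (simp add: pt_subcell low r Q_def R_def)
    show "xgen_low q r (pt q (leaf q (r + k)) t) = pt q (subcell q (leaf q r) 1 k) t"
    proof (cases "r + k < width q")
      case True
      define x where "x = (R + real k + t) / Q"
      have x: "pt q (leaf q (r + k)) t = x" using True by (simp add: low x_def Q_def R_def)
      have "R / Q \<le> x" "x \<le> (Q - 1) / Q"
        using t Q lt[OF True] unfolding x_def by (auto intro!: divide_right_mono simp: R_def)
      then have "xgen_low q r x = R / Q + (x - R / Q) / Q" by (rule pcs(2))
      also have "\<dots> = (R + (real k + t) / Q) / Q"
        using Q by (simp add: x_def field_simps)
      finally show ?thesis unfolding x rhs .
    next
      case False
      define u where "u = r + k - width q"
      have u: "r + k = u + width q" "u \<le> r" "u < width q"
        using False that r q_eq_width by (auto simp: u_def)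
      have ur: "real u = R + real k - (Q - 1)"
        using u(1) real_width by (simp add: R_def Q_def flip: of_nat_add)
      define x where "x = (Q - 1 + (real u + t) / Q) / Q"
      have x: "pt q (leaf q (r + k)) t = x" unfolding u(1) shift low[OF u(3)] x_def Q_def ..
      have x': "x = (Q - 1) / Q + (real u + t) / Q ^ 2"
        using Q by (simp add: x_def field_simps power2_eq_square)
      have "(Q - 1) / Q \<le> x" "x \<le> (Q - 1) / Q + (R + 1) / Q ^ 2"
        using t Q u(2) unfolding x' by (auto intro!: divide_right_mono simp: R_def)
      then have "xgen_low q r x = x - (Q - 1 - R) * (Q - 1) / Q ^ 2" by (rule pcs(3))
      also have "\<dots> = (R + (real k + t) / Q) / Q"
        using Q unfolding x' ur by (simp add: field_simps power2_eq_square)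
      finally show ?thesis unfolding x rhs .
    qed
  qed
  have cm3: "cell_map q (xgen_low q r) (leaf q (j + width q)) (leaf q j)" if "r < j" for j
    unfolding cell_map_def
  proof
    fix t :: real assume t: "t \<in> {0..1}"
    define y where "y = pt q (leaf q j) t"
    define x where "x = (Q - 1 + y) / Q"
    have x: "pt q (leaf q (j + width q)) t = x" unfolding shift x_def y_def Q_def ..
    have "y \<le> pt q (leaf q j) 1"
      using t pt_less[of t 1] unfolding y_def by (cases "t = 1") (auto simp: less_imp_le)
    then have y1: "y < 1" using inner_leaf[of j] inner_cell_iff[of "leaf q j"] by simp
    have "(R + 1) / Q = pt q (leaf q r) 1" by (simp add: low r R_def Q_def)
    also have "\<dots> = pt q (leaf q (Suc r)) 0" by (rule pt_leaf_next)
    also have "\<dots> \<le> pt q (leaf q j) 0"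
      using that strict_mono_less_eq[OF strict_mono_leaf] by simp
    also have "\<dots> \<le> y"
      using t pt_less[of 0 t] unfolding y_def by (cases "t = 0") (auto simp: less_imp_le)
    finally have "(R + 1) / Q / Q \<le> y / Q" using Q by (intro divide_right_mono) auto
    then have "(Q - 1) / Q + (R + 1) / Q ^ 2 \<le> x"
      unfolding x_def by (simp add: add_divide_distrib power2_eq_square)
    moreover have "x \<le> 1" using y1 Q by (simp add: x_def field_simps)
    ultimately have "xgen_low q r x = Q * x - (Q - 1)" by (rule pcs(4))
    also have "\<dots> = y" using Q by (simp add: x_def)
    finally show "xgen_low q r (pt q (leaf q (j + width q)) t) = pt q (leaf q j) t"
      unfolding x y_def[symmetric] .
  qed
  show ?thesis unfolding splits_leaf_def using cm1 cm2 cm3 by blast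
qed

lemma splits_leaf_xgen:
  assumes "i < q" shows "splits_leaf q (xgen q i) i"
proof (cases "i < width q")
  case True
  then show ?thesis by (simp add: xgen_low_eq splits_leaf_xgen_low)
next
  case False
  then have i: "i = width q" using assms q_eq_width by linarith
  note shift = pt_leaf_shift
  have s0: "splits_leaf q (xgen q 0) 0" by (simp add: xgen_low_eq splits_leaf_xgen_low)
  \<comment> \<open>The last generator acts on the last child of the root as \<open>xgen q 0\<close>
    acts on the whole interval.\<close>
  have up: "cell_map q (xgen q i) J' K'"
    if "cell_map q (xgen q 0) J K"
      and "\<And>t. t \<in> {0..1} \<Longrightarrow> pt q J' t = (real q - 1 + pt q J t) / real q"
      and "\<And>t. t \<in> {0..1} \<Longrightarrow> pt q K' t = (real q - 1 + pt q K t) / real q" for J K J' K'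
    using that by (simp add: cell_map_def i xgen_last)
  have h0: "homeo01 (xgen q 0)" by (rule homeo01_xgen) simp
  have "cell_map q (xgen q i) (leaf q j) (leaf q j)" if "j < i" for j
    unfolding cell_map_def
  proof
    fix t :: real assume t: "t \<in> {0..1}"
    have "real j + 1 \<le> real q - 1" using that i real_width by linarith
    then have "real q * pt q (leaf q j) t - (real q - 1) \<le> 0"
      using t that i by (simp add: pt_leaf_low)
    then have "xgen q 0 (real q * pt q (leaf q j) t - (real q - 1))
        = real q * pt q (leaf q j) t - (real q - 1)"
      using h0 unfolding homeo01_def by blast
    then show "xgen q i (pt q (leaf q j) t) = pt q (leaf q j) t"
      by (simp add: i xgen_last)
  qed
  moreover have "cell_map q (xgen q i) (leaf q (i + k)) (subcell q (leaf q i) 1 k)" if "k < q" for k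
  proof (rule up)
    show "cell_map q (xgen q 0) (leaf q (0 + k)) (subcell q (leaf q 0) 1 k)"
      using s0 that unfolding splits_leaf_def by blast
    show "pt q (leaf q (i + k)) t = (real q - 1 + pt q (leaf q (0 + k)) t) / real q" for t
      using shift[of k t] by (simp add: i add.commute)
    show "pt q (subcell q (leaf q i) 1 k) t
        = (real q - 1 + pt q (subcell q (leaf q 0) 1 k) t) / real q" for t
      unfolding pt_subcell using shift[of 0] by (simp add: i)
  qed
  moreover have "cell_map q (xgen q i) (leaf q (j + width q)) (leaf q j)" if "i < j" for j
  proof -
    define m where "m = j - width q"
    have m: "j = m + width q" "0 < m" using that i by (auto simp: m_def)
    show ?thesis
    proof (rule up)
      show "cell_map q (xgen q 0) (leaf q (m + width q)) (leaf q m)"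
        using s0 m unfolding splits_leaf_def by blast
    qed (simp_all only: m(1) shift)
  qed
  ultimately show ?thesis unfolding splits_leaf_def by blast
qed

lemma splits_leaf_cases:
  assumes "splits_leaf q x i"
  obtains (left) "j < i" "cell_map q x (leaf q j) (leaf q j)"
  | (child) k where "j = i + k" "k < q" "cell_map q x (leaf q j) (subcell q (leaf q i) 1 k)"
  | (right) m where "j = m + width q" "i < m" "cell_map q x (leaf q j) (leaf q m)"
proof -
  consider "j < i" | "i \<le> j" "j < i + q" | "i + q \<le> j" by linarith
  then show thesis
  proof cases
    case 1
    then show thesis using assms left unfolding splits_leaf_def by blast
  next
    case 2
    then have "j = i + (j - i)" "j - i < q" by auto
    then show thesis using assms child[of "j - i"] unfolding splits_leaf_def by metis
  next
    case 3
    then have "j = (j - width q) + width q" "i < j - width q"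
      using q_eq_width by linarith+
    then show thesis using assms right[of "j - width q"] unfolding splits_leaf_def by metis
  qed
qed

text \<open>Leaves go to leaves other than \<open>i\<close> or to children of leaf \<open>i\<close>,
  and none of these contains leaf \<open>i\<close>. That leaf \<open>i\<close> is missed makes the
  count of bad cells drop strictly.\<close>

lemma splits_leaf_inner:
  assumes "splits_leaf q x i" "homeo01 x" "inner_cell q J"
  shows "\<exists>K. cell_map q x J K \<and> inner_cell q K \<and> K \<noteq> leaf q i"
proof -
  obtain j n c where c: "c < q ^ n" and J: "J = subcell q (leaf q j) n c"
    using inner_cell_in_leaf[OF assms(3)] by blast
  note sub = cell_map_subcell[OF _ c]
  have "\<exists>K. cell_map q x J K \<and> K \<noteq> leaf q i"
  proof (cases rule: splits_leaf_cases[OF assms(1), of j, case_names left child right])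
    case left
    then show ?thesis using sub J subcell_eq_leafD(3)[OF _ c] by blast
  next
    case (child k)
    have "subcell q (subcell q (leaf q i) 1 k) n c \<noteq> leaf q i"
      unfolding subcell_subcell
      using subcell_eq_leafD(1) subcell_index_less[OF _ c, of k 1] child(2) by fastforce
    then show ?thesis using sub[OF child(3)] J by blast
  next
    case (right m)
    then show ?thesis using sub J subcell_eq_leafD(3)[OF _ c] by blast
  qed
  then show ?thesis using cell_map_inner[OF assms(2,3)] by blast
qed

text \<open>The generators below \<open>width q\<close> have their last affine piece on at least
  \<open>[1 - 1 / q ^ 2, 1]\<close>. The last generator is a copy of \<open>xgen q 0\<close> in the
  last child of the root, which costs one more power of \<open>q\<close>.\<close>

lemma xgen_near_1:
  assumes "i < q" "1 - 1 / real q ^ 3 \<le> t" "t \<le> 1"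
  shows "xgen q i t = real q * t - (real q - 1)"
proof -
  define Q where "Q = real q"
  have Q: "2 \<le> Q" using q2 by (simp add: Q_def)
  have low: "xgen q r s = Q * s - (Q - 1)" if r: "r < width q" and s: "1 - 1 / Q ^ 2 \<le> s" "s \<le> 1" for r s
  proof -
    have "real r + 1 \<le> Q - 1" using r real_width Q_def by linarith
    then have "(Q - 1) / Q + (real r + 1) / Q ^ 2 \<le> (Q - 1) / Q + (Q - 1) / Q ^ 2"
      by (intro add_left_mono divide_right_mono) auto
    also have "\<dots> = 1 - 1 / Q ^ 2" using Q by (simp add: field_simps power2_eq_square)
    finally show ?thesis
      using s xgen_low_pieces(4)[OF r, of s] by (simp add: xgen_low_eq[OF r] Q_def)
  qed
  have q3: "1 / Q ^ 3 \<le> 1 / Q ^ 2" using Q by (intro divide_left_mono power_increasing) auto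
  show ?thesis
  proof (cases "i < width q")
    case True
    then show ?thesis using low[of i t] assms q3 by (simp add: Q_def)
  next
    case False
    then have i: "i = width q" using assms q_eq_width by linarith
    have "Q * (1 - 1 / Q ^ 3) \<le> Q * t" using assms(2) Q by (intro mult_left_mono) (auto simp: Q_def)
    moreover have "Q * (1 - 1 / Q ^ 3) = Q - 1 / Q ^ 2"
      using Q by (simp add: field_simps power3_eq_cube power2_eq_square)
    moreover have "Q * t \<le> Q" using assms(3) Q by simp
    ultimately have "xgen q 0 (Q * t - (Q - 1)) = Q * (Q * t - (Q - 1)) - (Q - 1)"
      by (intro low) auto
    then have "xgen q i t = (Q - 1 + (Q * (Q * t - (Q - 1)) - (Q - 1))) / Q"
      unfolding i xgen_last Q_def by simp
    then show ?thesis using Q by (simp add: Q_def)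
  qed
qed

text \<open>Depth 3 suffices: inner cells are always good, and the spine cell of depth 3 is in the
  range of \<open>xgen_near_1\<close> and goes to the spine cell of depth 2.\<close>

lemma xgen_tame_homeos:
  assumes "i < q" shows "xgen q i \<in> tame_homeos q"
proof -
  note h = homeo01_xgen[OF assms]
  have "good q (xgen q i) (a, 3)" if "a < q ^ 3" for a
  proof (cases "inner_cell q (a, 3)")
    case True
    then show ?thesis
      using splits_leaf_inner[OF splits_leaf_xgen[OF assms] h] unfolding good_def by blast
  next
    case False
    then have "a + 1 = q ^ 3" using that by (simp add: inner_cell_def)
    then have "real (a + 1) = real (q ^ 3)" by (simp only:)
    then have a: "real a = real q ^ 3 - 1" by simp
    have b: "real (q ^ 2 - 1) = real q ^ 2 - 1" using q2 by (simp add: of_nat_diff)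
    have "cell_map q (xgen q i) (a, 3) (q ^ 2 - 1, 2)"
      unfolding cell_map_def
    proof
      fix t :: real assume t: "t \<in> {0..1}"
      have p: "pt q (a, 3) t = (real q ^ 3 - 1 + t) / real q ^ 3" by (simp add: pt_def a)
      have "1 - 1 / real q ^ 3 \<le> pt q (a, 3) t" "pt q (a, 3) t \<le> 1"
        using t q2 unfolding p by (auto simp: field_simps)
      then have "xgen q i (pt q (a, 3) t) = real q * pt q (a, 3) t - (real q - 1)"
        by (rule xgen_near_1[OF assms])
      also have "\<dots> = pt q (q ^ 2 - 1, 2) t"
        unfolding p unfolding pt_def fst_conv snd_conv b using q2
        by (simp add: field_simps power2_eq_square power3_eq_cube)
      finally show "xgen q i (pt q (a, 3) t) = pt q (q ^ 2 - 1, 2) t" .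
    qed
    then show ?thesis unfolding good_def by blast
  qed
  then show ?thesis using h by (auto simp: tame_homeos_def)
qed

lemma xi_low: "i < q \<Longrightarrow> xi q i = xgen q i"
proof -
  assume "i < q"
  then have "i - 1 < width q" using q_eq_width q_pos(5) by linarith
  then have "(i - 1) div width q = 0" by simp
  then show ?thesis unfolding xi_def Let_def by simp
qed

text \<open>The relation of the infinite presentation for conjugation by
  \<open>x\<^sub>0\<close>.\<close>

lemma xi_shift:
  assumes "1 \<le> i" shows "xi q (i + width q) = inv (xgen q 0) \<circ> xi q i \<circ> xgen q 0"
proof -
  define c where "c = (i - 1) div width q"
  have "i + width q - 1 = (i - 1) + width q" using assms by simp
  then have c': "(i + width q - 1) div width q = Suc c" by (simp add: c_def)
  have i': "i + width q - Suc c * width q = i - c * width q" by simp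
  show ?thesis
    unfolding xi_def Let_def c' i' c_def[symmetric]
    unfolding funpow_Suc_right[of c "xgen q 0"] by (simp add: comp_assoc)
qed

lemma xi_induct [case_names low shift]:
  assumes "\<And>i. i < q \<Longrightarrow> P i" "\<And>i. 1 \<le> i \<Longrightarrow> P i \<Longrightarrow> P (i + width q)"
  shows "P i"
proof (induction i rule: less_induct)
  case (less i)
  show ?case
  proof (cases "i < q")
    case False
    then have "1 \<le> i - width q" "i - width q < i" "i = (i - width q) + width q"
      using q_eq_width q_pos(5) by linarith+
    then show ?thesis using less assms(2) by metis
  qed (rule assms)
qed

lemma homeo01_xi: "homeo01 (xi q i)"
proof (induction i rule: xi_induct)
  case (low i)
  then show ?case by (simp add: xi_low homeo01_xgen)
next
  case (shift i)
  have "homeo01 (xgen q 0)" by (rule homeo01_xgen) simp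
  then show ?case unfolding xi_shift[OF shift(1)] using shift(2)
    by (intro homeo01_comp homeo01_inv)
qed

lemma homeo01_xi_prod: "homeo01 (xi_prod q L)"
proof (induction L)
  case Nil
  show ?case unfolding xi_prod_simps by (rule homeo01_id)
next
  case (Cons i L)
  show ?case unfolding xi_prod_simps by (rule homeo01_comp[OF homeo01_xi Cons])
qed

text \<open>Conjugating by the generator 0 moves the leaf that is split to the right by one caret.\<close>
lemma splits_leaf_xi: "splits_leaf q (xi q i) i"
proof (induction i rule: xi_induct)
  case (low i)
  then show ?case by (simp add: xi_low splits_leaf_xgen)
next
  case (shift i)
  define x where "x = xgen q 0"
  have hx: "homeo01 x" unfolding x_def by (rule homeo01_xgen) simp
  have s0: "splits_leaf q x 0" unfolding x_def by (rule splits_leaf_xgen) simp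
  have conj: "cell_map q (xi q (i + width q)) J K'"
    if "cell_map q x J J'" "cell_map q (xi q i) J' K" "cell_map q x K' K" for J J' K K'
    unfolding xi_shift[OF shift(1)] x_def[symmetric]
    by (intro cell_map_comp[OF that(1)] cell_map_comp[OF that(2)] cell_map_inv[OF hx that(3)])
  have x0: "cell_map q x (leaf q k) (subcell q (leaf q 0) 1 k)" if "k < q" for k
    using s0 that unfolding splits_leaf_def by (metis add_0)
  have x1: "cell_map q x (leaf q (j + width q)) (leaf q j)" if "0 < j" for j
    using s0 that unfolding splits_leaf_def by blast
  have s1: "cell_map q (xi q i) (leaf q j) (leaf q j)" if "j < i" for j
    using shift(2) that unfolding splits_leaf_def by blast
  have s2: "cell_map q (xi q i) (leaf q (i + k)) (subcell q (leaf q i) 1 k)" if "k < q" for k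
    using shift(2) that unfolding splits_leaf_def by blast
  have s3: "cell_map q (xi q i) (leaf q (j + width q)) (leaf q j)" if "i < j" for j
    using shift(2) that unfolding splits_leaf_def by blast
  have "cell_map q (xi q (i + width q)) (leaf q j) (leaf q j)" if "j < i + width q" for j
  proof (cases "j < q")
    case True
    \<comment> \<open>\<open>x\<close> carries the first \<open>q\<close> leaves into leaf 0, which
      \<open>xi q i\<close> fixes pointwise because \<open>i\<close> is positive.\<close>
    have "cell_map q (xi q i) (subcell q (leaf q 0) 1 j) (subcell q (leaf q 0) 1 j)"
      using cell_map_subcell[OF s1[of 0], of j 1] shift(1) True by simp
    then show ?thesis using conj x0[OF True] by blast
  next
    case False
    define m where "m = j - width q"
    have m: "j = m + width q" "0 < m" using False q_eq_width unfolding m_def by linarith+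
    then show ?thesis using conj[OF x1 s1 x1] that by simp
  qed
  moreover have "cell_map q (xi q (i + width q)) (leaf q (i + width q + k))
      (subcell q (leaf q (i + width q)) 1 k)" if "k < q" for k
  proof -
    have e: "i + width q + k = (i + k) + width q" by simp
    have "cell_map q x (subcell q (leaf q (i + width q)) 1 k) (subcell q (leaf q i) 1 k)"
      using cell_map_subcell[OF x1[of i], of k 1] shift(1) that by simp
    then show ?thesis unfolding e using conj[OF x1 s2[OF that]] shift(1) by simp
  qed
  moreover have "cell_map q (xi q (i + width q)) (leaf q (j + width q)) (leaf q j)"
    if "i + width q < j" for j
  proof -
    define m where "m = j - width q"
    have m: "j = m + width q" "i < m" using that unfolding m_def by linarith+
    then show ?thesis using conj[OF x1[of j] s3[of m, folded m(1)] x1[of m, folded m(1)]] by simp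
  qed
  ultimately show ?case unfolding splits_leaf_def by blast
qed

subsection \<open>Straightening a homeomorphism\<close>

text \<open>Taking images under \<open>x\<close> injects the inner bad cells of the product into
  those of \<open>f\<close> and misses the bad leaf \<open>i\<close>.\<close>

lemma inner_bad_comp_less:
  assumes x: "homeo01 x" "splits_leaf q x i" and f: "\<not> good q f (leaf q i)" "finite (inner_bad q f)"
  shows "finite (inner_bad q (f \<circ> x))" "card (inner_bad q (f \<circ> x)) < card (inner_bad q f)"
proof -
  obtain im where im: "\<And>J. inner_cell q J \<Longrightarrow>
      cell_map q x J (im J) \<and> inner_cell q (im J) \<and> im J \<noteq> leaf q i"
    using splits_leaf_inner[OF x(2,1)] by metis
  have inj: "inj_on im (inner_bad q (f \<circ> x))"
    by (rule inj_onI) (metis (lifting) im inner_bad_def mem_Collect_eq cell_map_inject[OF x(1)])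
  have sub: "im ` inner_bad q (f \<circ> x) \<subseteq> inner_bad q f - {leaf q i}"
  proof
    fix K assume "K \<in> im ` inner_bad q (f \<circ> x)"
    then obtain J where J: "inner_cell q J" "\<not> good q (f \<circ> x) J" "K = im J"
      by (auto simp: inner_bad_def bad_cells_def)
    then have "\<not> good q f K" using im[OF J(1)] cell_map_comp unfolding good_def by blast
    then show "K \<in> inner_bad q f - {leaf q i}"
      using im[OF J(1)] J(3) inner_imp_std by (simp add: inner_bad_def bad_cells_def)
  qed
  have fin: "finite (inner_bad q f - {leaf q i})" using f(2) by simp
  show "finite (inner_bad q (f \<circ> x))" using inj sub fin finite_imageD finite_subset by blast
  have "leaf q i \<in> inner_bad q f"
    using f(1) inner_leaf inner_imp_std by (simp add: inner_bad_def bad_cells_def)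
  then have "card (inner_bad q f - {leaf q i}) < card (inner_bad q f)"
    using f(2) by (intro psubset_card_mono) auto
  moreover have "card (inner_bad q (f \<circ> x)) \<le> card (inner_bad q f - {leaf q i})"
    using inj sub fin by (meson card_inj_on_le)
  ultimately show "card (inner_bad q (f \<circ> x)) < card (inner_bad q f)" by simp
qed

text \<open>The inverse of \<open>f\<close> takes a leaf to an inner cell, which is not leaf
  \<open>i\<close> since that one is bad for \<open>f\<close>. Every inner cell except those equal
  to leaf \<open>i\<close> lies in another leaf or in a child of leaf \<open>i\<close>, and there
  the inverse of \<open>x\<close> is affine.\<close>

lemma good_inv_comp:
  assumes h: "homeo01 f" "homeo01 x" and x: "splits_leaf q x i" and f: "\<not> good q f (leaf q i)"
    and inv: "\<And>j. good q (inv f) (leaf q j)"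
  shows "good q (inv (f \<circ> x)) (leaf q j)"
proof -
  have e: "inv (f \<circ> x) = inv x \<circ> inv f"
    using h by (intro o_inv_distrib homeo01_bij)
  obtain K where K: "cell_map q (inv f) (leaf q j) K" using inv unfolding good_def by blast
  have "inner_cell q K" using cell_map_inner[OF homeo01_inv[OF h(1)] inner_leaf K] .
  then obtain m n c where c: "c < q ^ n" and Kc: "K = subcell q (leaf q m) n c"
    using inner_cell_in_leaf by blast
  have "good q (inv x) K"
  proof (cases "m = i")
    case True
    have "n \<noteq> 0"
    proof
      assume "n = 0"
      then have "K = leaf q i" using c Kc True by (simp add: subcell_def)
      then have "cell_map q (inv (inv f)) (leaf q i) (leaf q j)"
        using cell_map_inv[OF homeo01_inv[OF h(1)] K] by simp
      then show False
        using f unfolding good_def inv_inv_eq[OF homeo01_bij[OF h(1)]] by blast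
    qed
    then obtain l where l: "n = 1 + l" by (metis not0_implies_Suc plus_1_eq_Suc)
    have b: "c div q ^ l < q" using c l by (simp add: less_mult_imp_div_less)
    have "K = subcell q (subcell q (leaf q i) 1 (c div q ^ l)) l (c mod q ^ l)"
      unfolding subcell_subcell by (simp add: Kc True l div_mult_mod_eq)
    moreover have "cell_map q x (leaf q (i + c div q ^ l)) (subcell q (leaf q i) 1 (c div q ^ l))"
      using x b unfolding splits_leaf_def by blast
    ultimately show ?thesis
      using good_subcell[OF good_inv_image[OF h(2)]] by simp
  next
    case False
    then consider "m < i" | "i < m" by linarith
    then have "\<exists>J. cell_map q x J (leaf q m)" using x unfolding splits_leaf_def by cases blast+
    then show ?thesis
      unfolding Kc using good_subcell[OF good_inv_image[OF h(2)] c] by blast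
  qed
  then show ?thesis unfolding e good_def using K cell_map_comp by blast
qed

text \<open>The last clause ensures that straightening the inverse of a straightened map does not undo
  what the first straightening achieved.\<close>
lemma straighten_list:
  assumes "homeo01 f" "finite (inner_bad q f)" "card (inner_bad q f) = n"
    and "\<And>j. m \<le> j \<Longrightarrow> good q f (leaf q j)"
  shows "\<exists>L. sorted L \<and> length L \<le> n \<and> (\<forall>i\<in>set L. i < m + n * width q)
    \<and> (\<forall>i\<in>set L. \<exists>j\<le>i. \<not> good q f (leaf q j)) \<and> (\<forall>j. good q (f \<circ> xi_prod q L) (leaf q j))
    \<and> ((\<forall>j. good q (inv f) (leaf q j)) \<longrightarrow> (\<forall>j. good q (inv (f \<circ> xi_prod q L)) (leaf q j)))"
  using assms
proof (induction n arbitrary: f m rule: less_induct)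
  case (less n)
  show ?case
  proof (cases "\<forall>j. good q f (leaf q j)")
    case True
    then show ?thesis by (intro exI[of _ "[]"]) simp
  next
    case False
    define i where "i = (LEAST i. \<not> good q f (leaf q i))"
    have i: "\<not> good q f (leaf q i)" unfolding i_def using False by (metis (lifting) LeastI_ex)
    have lt: "good q f (leaf q j)" if "j < i" for j
      using that not_less_Least unfolding i_def by blast
    have im: "i < m" using i less.prems(4) not_le by blast
    define x where "x = xi q i"
    have hx: "homeo01 x" and sx: "splits_leaf q x i"
      unfolding x_def by (rule homeo01_xi splits_leaf_xi)+
    define n' where "n' = card (inner_bad q (f \<circ> x))"
    note step = inner_bad_comp_less[OF hx sx i less.prems(2)]
    have n': "n' < n" using step less.prems(3) by (simp add: n'_def)
    \<comment> \<open>Right of leaf \<open>i\<close>, \<open>x\<close> moves leaves one caret to the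
      left, so the bound beyond which all leaves are good grows by one caret per step.\<close>
    have tail: "good q (f \<circ> x) (leaf q j)" if "m + width q \<le> j" for j
    proof -
      define l where "l = j - width q"
      have l: "j = l + width q" "i < l" "m \<le> l" using that im by (auto simp: l_def)
      then have "cell_map q x (leaf q j) (leaf q l)" using sx unfolding splits_leaf_def by blast
      then show ?thesis using less.prems(4)[OF l(3)] cell_map_comp unfolding good_def by blast
    qed
    obtain L where L: "sorted L" "length L \<le> n'" "\<forall>i\<in>set L. i < m + width q + n' * width q"
      "\<forall>i\<in>set L. \<exists>j\<le>i. \<not> good q (f \<circ> x) (leaf q j)"
      "\<forall>j. good q ((f \<circ> x) \<circ> xi_prod q L) (leaf q j)"
      "(\<forall>j. good q (inv (f \<circ> x)) (leaf q j)) \<longrightarrow>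
        (\<forall>j. good q (inv ((f \<circ> x) \<circ> xi_prod q L)) (leaf q j))"
      using less.IH[OF n' homeo01_comp[OF less.prems(1) hx] step(1) n'_def[symmetric], of "m + width q"]
        tail by blast
    \<comment> \<open>Leaves left of \<open>i\<close> are good for \<open>f\<close> and fixed by
      \<open>x\<close>, so they stay good and all later indices are at least \<open>i\<close>; this
      makes the list sorted.\<close>
    have ge: "i \<le> l" if "l \<in> set L" for l
    proof -
      obtain j where j: "j \<le> l" "\<not> good q (f \<circ> x) (leaf q j)" using L(4) \<open>l \<in> set L\<close> by blast
      have "\<not> j < i"
      proof
        assume "j < i"
        then have "cell_map q x (leaf q j) (leaf q j)" using sx unfolding splits_leaf_def by blast
        then show False using j(2) lt[OF \<open>j < i\<close>] cell_map_comp unfolding good_def by blast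
      qed
      then show ?thesis using j(1) by simp
    qed
    have eq: "f \<circ> xi_prod q (i # L) = (f \<circ> x) \<circ> xi_prod q L" by (simp add: x_def comp_assoc)
    have "Suc n' * width q \<le> n * width q" using n' by (intro mult_right_mono) auto
    then have bound: "m + width q + n' * width q \<le> m + n * width q" by simp
    have inv: "\<forall>j. good q (inv (f \<circ> x)) (leaf q j)" if "\<forall>j. good q (inv f) (leaf q j)"
      using good_inv_comp[OF less.prems(1) hx sx i] that by blast
    have "sorted (i # L)" using L(1) ge by simp
    moreover have "length (i # L) \<le> n" using L(2) n' by simp
    moreover have "\<forall>l\<in>set (i # L). l < m + n * width q" using L(3) bound im by fastforce
    moreover have "\<forall>l\<in>set (i # L). \<exists>j\<le>l. \<not> good q f (leaf q j)" using ge i by auto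
    ultimately show ?thesis using L(5,6) inv unfolding eq[symmetric] by blast
  qed
qed

text \<open>A cell that contains a bad cell is bad, so a bad leaf \<open>j\<close> makes the spine
  cells \<open>s e\<close> above it bad, one for each depth \<open>e\<close> from 0 to
  \<open>j div width q\<close>.\<close>

lemma good_leaf_beyond_bad:
  assumes "finite (bad_cells q f)" "card (bad_cells q f) * width q \<le> j"
  shows "good q f (leaf q j)"
proof (rule ccontr)
  assume bad: "\<not> good q f (leaf q j)"
  define d r where "d = j div width q" and "r = j mod width q"
  define s where "s e = (q ^ e - 1, e)" for e
  have "s e \<in> bad_cells q f" if "e \<le> d" for e
  proof -
    define n c where "n = d - e + 1" and "c = q ^ n - q + r"
    have rq: "r < q"
      unfolding r_def using mod_less_divisor[of "width q" j] q_eq_width q_pos(5) by linarith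
    have qn: "q \<le> q ^ n" by (simp add: n_def)
    have c: "c < q ^ n" unfolding c_def using qn rq by linarith
    have en: "d + 1 = e + n" using that by (simp add: n_def)
    have "(q ^ e - 1) * q ^ n + c = q ^ (d + 1) - q + r"
    proof -
      have "(q ^ e - 1) * q ^ n = q ^ (d + 1) - q ^ n"
        unfolding en by (simp add: diff_mult_distrib power_add)
      moreover have "q ^ n \<le> q ^ (d + 1)" unfolding en by (simp add: power_add)
      ultimately show ?thesis using qn unfolding c_def by linarith
    qed
    moreover have "leaf q j = (q ^ (d + 1) - q + r, d + 1)" by (simp only: leaf_def d_def r_def)
    moreover have "subcell q (s e) n c = ((q ^ e - 1) * q ^ n + c, e + n)"
      by (simp add: subcell_def s_def)
    ultimately have "leaf q j = subcell q (s e) n c" using en by (simp only:)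
    then have "\<not> good q f (s e)" using bad good_subcell[OF _ c] by metis
    then show ?thesis by (simp add: bad_cells_def std_cell_def s_def)
  qed
  then have "s ` {..d} \<subseteq> bad_cells q f" by auto
  then have "card (s ` {..d}) \<le> card (bad_cells q f)" using assms(1) by (rule card_mono[rotated])
  moreover have "inj_on s {..d}" by (rule inj_onI) (simp add: s_def)
  ultimately have "Suc d \<le> card (bad_cells q f)" by (simp add: card_image)
  then have "Suc d * width q \<le> j" using assms(2) by (meson mult_le_mono1 order_trans)
  moreover have "j < Suc d * width q"
    unfolding d_def using dividend_less_times_div[of "width q" j] by (simp add: mult.commute)
  ultimately show False by simp
qed

text \<open>Each factor is a conjugate by a power of \<open>x\<^sub>0\<close>. As the indices
  increase, adjacent powers collapse to powers of the inverse: at most \<open>C - c\<close> inverse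
  letters, one generator per entry and a final power of at most \<open>C\<close>. The exponent
  \<open>c\<close> is what the preceding factor leaves over.\<close>

lemma word_ball_xi_prod:
  assumes "sorted L" "\<forall>i\<in>set L. c \<le> (i - 1) div width q \<and> (i - 1) div width q \<le> C" "c \<le> C"
  shows "word_ball q (length L + (C - c) + C) ((xgen q 0 ^^ c) \<circ> xi_prod q L)"
  using assms
proof (induction L arbitrary: c)
  case Nil
  have "word_ball q 1 (xgen q 0)" using word_ball_letter[of 0 q True] by (simp add: letter_def)
  from word_ball_funpow[OF this, of c] show ?case
    using Nil.prems(3) by (auto elim: word_ball_mono)
next
  case (Cons i L)
  define x where "x = xgen q 0"
  define d where "d = (i - 1) div width q"
  define r where "r = i - d * width q"
  have cd: "c \<le> d" "d \<le> C" using Cons.prems(2) by (auto simp: d_def)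
  have "r < q"
  proof -
    have "i - 1 < d * width q + width q"
      unfolding d_def using dividend_less_div_times[of "width q" "i - 1"] by simp
    then show ?thesis unfolding r_def using q_eq_width by linarith
  qed
  have sx: "surj x" using homeo01_xgen[of 0] by (simp add: x_def homeo01_def)
  have "word_ball q (length L + (C - d) + C) ((x ^^ d) \<circ> xi_prod q L)"
    unfolding x_def
  proof (rule Cons.IH)
    show "\<forall>i\<in>set L. d \<le> (i - 1) div width q \<and> (i - 1) div width q \<le> C"
      using Cons.prems(1,2) unfolding d_def by (auto intro!: div_le_mono diff_le_mono)
  qed (use Cons.prems cd in auto)
  moreover have "word_ball q 1 (xgen q r)"
    using word_ball_letter[OF \<open>r < q\<close>, of True] by (simp add: letter_def)
  moreover have "word_ball q 1 (inv x)"
    using word_ball_letter[of 0 q False] by (simp add: letter_def x_def)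
  ultimately have R: "word_ball q ((d - c) + (1 + (length L + (C - d) + C)))
      ((inv x ^^ (d - c)) \<circ> (xgen q r \<circ> ((x ^^ d) \<circ> xi_prod q L)))"
    by (intro word_ball_comp[OF word_ball_funpow word_ball_comp])
  have "x ^^ c \<circ> inv x ^^ d = x ^^ c \<circ> (inv x ^^ c \<circ> inv x ^^ (d - c))"
    using cd by (simp add: funpow_add[symmetric])
  also have "\<dots> = inv x ^^ (d - c)"
    unfolding comp_assoc[symmetric] funpow_inv_cancel[OF sx] by simp
  finally have "x ^^ c \<circ> inv x ^^ d = inv x ^^ (d - c)" .
  moreover have "xi q i = (inv x ^^ d) \<circ> xgen q r \<circ> (x ^^ d)"
    unfolding xi_def Let_def d_def r_def x_def ..
  ultimately have eq: "(x ^^ c) \<circ> xi_prod q (i # L)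
      = (inv x ^^ (d - c)) \<circ> (xgen q r \<circ> ((x ^^ d) \<circ> xi_prod q L))"
    unfolding xi_prod_simps by (metis comp_assoc)
  have "(d - c) + (1 + (length L + (C - d) + C)) \<le> length (i # L) + (C - c) + C" using cd by simp
  then show ?case unfolding x_def[symmetric] eq by (rule word_ball_mono[OF R])
qed

lemma straighten:
  assumes "f \<in> tame_homeos q"
  shows "\<exists>\<phi>. homeo01 \<phi> \<and> word_ball q (5 * card (bad_cells q f)) \<phi> \<and> (\<forall>j. good q (f \<circ> \<phi>) (leaf q j))
    \<and> ((\<forall>j. good q (inv f) (leaf q j)) \<longrightarrow> (\<forall>j. good q (inv (f \<circ> \<phi>)) (leaf q j)))"
proof -
  define N where "N = card (bad_cells q f)"
  have h: "homeo01 f" and fin: "finite (bad_cells q f)" using assms by (auto simp: tame_homeos_iff)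
  have sub: "inner_bad q f \<subseteq> bad_cells q f" by (auto simp: inner_bad_def)
  have n: "card (inner_bad q f) \<le> N" unfolding N_def using sub fin by (rule card_mono[rotated])
  obtain L where L: "sorted L" "length L \<le> card (inner_bad q f)"
    "\<forall>i\<in>set L. i < N * width q + card (inner_bad q f) * width q"
    "\<forall>j. good q (f \<circ> xi_prod q L) (leaf q j)"
    "(\<forall>j. good q (inv f) (leaf q j)) \<longrightarrow> (\<forall>j. good q (inv (f \<circ> xi_prod q L)) (leaf q j))"
    using straighten_list[OF h finite_subset[OF sub fin] refl good_leaf_beyond_bad[OF fin]]
    unfolding N_def by blast
  \<comment> \<open>The first \<open>N\<close> carets contain all bad leaves, and each of at most
    \<open>N\<close> straightening steps adds one caret.\<close>
  have "(i - 1) div width q \<le> 2 * N" if "i \<in> set L" for i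
  proof -
    have "card (inner_bad q f) * width q \<le> N * width q" using n by (rule mult_le_mono1)
    then have "i - 1 \<le> (2 * N) * width q" using bspec[OF L(3) that] by linarith
    then show ?thesis using div_le_mono[of "i - 1" "(2 * N) * width q" "width q"] by simp
  qed
  then have "word_ball q (length L + (2 * N - 0) + 2 * N) ((xgen q 0 ^^ 0) \<circ> xi_prod q L)"
    using L(1) by (intro word_ball_xi_prod) auto
  \<comment> \<open>The 5 is 1 for the entries of the list and twice 2 for the powers of
    \<open>x\<^sub>0\<close>.\<close>
  then have "word_ball q (5 * N) (xi_prod q L)" using L(2) n by (auto elim!: word_ball_mono)
  then show ?thesis using L(4,5) homeo01_xi_prod unfolding N_def by blast
qed

text \<open>Such a map permutes the leaves. From left to right, a leaf whose left endpoint is fixed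
  goes to the leaf with that endpoint, hence to itself.\<close>

lemma good_leaves_imp_id:
  assumes h: "homeo01 h" and g: "\<And>j. good q h (leaf q j)" "\<And>j. good q (inv h) (leaf q j)"
  shows "h = id"
proof -
  have perm: "\<exists>m. cell_map q h (leaf q j) (leaf q m)" for j
  proof -
    obtain K where K: "cell_map q h (leaf q j) K" using g(1) unfolding good_def by blast
    obtain m n c where c: "c < q ^ n" and Kc: "K = subcell q (leaf q m) n c"
      using inner_cell_in_leaf[OF cell_map_inner[OF h inner_leaf K]] by blast
    obtain J where J: "cell_map q (inv h) (leaf q m) J" using g(2) unfolding good_def by blast
    obtain m' n' c' where c': "c' < q ^ n'" and Jc: "J = subcell q (leaf q m') n' c'"
      using inner_cell_in_leaf[OF cell_map_inner[OF homeo01_inv[OF h] inner_leaf J]]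
      by blast
    have "cell_map q (inv h) K (subcell q J n c)" unfolding Kc by (rule cell_map_subcell[OF J c])
    \<comment> \<open>Going forth and back exhibits leaf \<open>j\<close> as a subcell of a leaf,
      which is only possible trivially.\<close>
    then have "subcell q J n c = leaf q j"
      using cell_map_inv[OF h K] cell_map_unique by blast
    then have "n' + n = 0"
      using subcell_eq_leafD(1)[OF _ subcell_index_less[OF c' c]]
      unfolding Jc subcell_subcell by blast
    then have "K = leaf q m" using Kc c by (simp add: subcell_def)
    then show ?thesis using K by blast
  qed
  have fix_left: "h (pt q (leaf q j) 0) = pt q (leaf q j) 0 \<Longrightarrow> cell_map q h (leaf q j) (leaf q j)" for j
  proof -
    assume a: "h (pt q (leaf q j) 0) = pt q (leaf q j) 0"
    obtain m where m: "cell_map q h (leaf q j) (leaf q m)" using perm by blast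
    then have "h (pt q (leaf q j) 0) = pt q (leaf q m) 0" by (simp add: cell_map_def)
    then have "j = m" using a leaf_eq_iff by metis
    then show ?thesis using m by simp
  qed
  have "cell_map q h (leaf q j) (leaf q j)" for j
  proof (induction j)
    case 0
    show ?case by (rule fix_left) (use h in \<open>simp add: pt_leaf_0_0 homeo01_def\<close>)
  next
    case (Suc j)
    show ?case
      by (rule fix_left) (use Suc in \<open>simp add: cell_map_def flip: pt_leaf_next\<close>)
  qed
  then have "h x = x" if "0 \<le> x" "x < 1" for x
    using leaf_cover[OF that] by (auto simp: cell_map_def)
  moreover have "h x = x" if "x \<le> 0 \<or> 1 \<le> x" for x using h that unfolding homeo01_def by blast
  ultimately have "h x = x" for x by (metis linorder_not_le less_imp_le)
  then show ?thesis by auto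
qed

end

subsection \<open>Word length and bad cells\<close>

lemma word_length_word_ball:
  assumes "word_ball q n g"
  shows "word_ball q (word_length q g) g" "word_length q g \<le> n"
proof -
  obtain w where w: "length w \<le> n" "\<forall>l\<in>set w. fst l < q" "eval_word q w = g"
    using assms unfolding word_ball_def by blast
  let ?P = "\<lambda>n. \<exists>w. length w = n \<and> (\<forall>l\<in>set w. fst l < q) \<and> eval_word q w = g"
  have P: "?P (length w)" using w by blast
  have "?P (word_length q g)" unfolding word_length_def by (rule LeastI[of ?P, OF P])
  then show "word_ball q (word_length q g) g" unfolding word_ball_def by (metis order_refl)
  have "word_length q g \<le> length w" unfolding word_length_def by (rule Least_le[of ?P, OF P])
  then show "word_length q g \<le> n" using w(1) by simp
qed

text \<open>Generators are those of base \<open>q\<close> and cells those of base \<open>p\<close>,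
  so that \<open>q = p ^ k\<close> is covered as well as \<open>q = p\<close>. Counts of bad cells
  are subadditive, so a bound \<open>M\<close> on letters is enough.\<close>

lemma word_ball_bad_cells:
  assumes p2: "2 \<le> p" and gens: "\<And>i. i < q \<Longrightarrow> xgen q i \<in> tame_homeos p"
  shows "\<exists>M. \<forall>n g. word_ball q n g \<longrightarrow> g \<in> tame_homeos p
    \<and> card (bad_cells p g) \<le> M * n \<and> card (bad_cells p (inv g)) \<le> M * n"
proof -
  define M where
    "M = (\<Sum>i<q. card (bad_cells p (xgen q i)) + card (bad_cells p (inv (xgen q i))))"
  have M: "card (bad_cells p (xgen q i)) + card (bad_cells p (inv (xgen q i))) \<le> M" if "i < q" for i
    unfolding M_def using that
      member_le_sum[of i "{..<q}" "\<lambda>i. card (bad_cells p (xgen q i)) + card (bad_cells p (inv (xgen q i)))"]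
    by simp
  have l: "letter q l \<in> tame_homeos p \<and> card (bad_cells p (letter q l)) \<le> M
      \<and> card (bad_cells p (inv (letter q l))) \<le> M" if "fst l < q" for l
  proof -
    have G: "xgen q (fst l) \<in> tame_homeos p" using gens that by blast
    then have "inv (inv (xgen q (fst l))) = xgen q (fst l)"
      by (intro inv_inv_eq homeo01_bij) (simp add: tame_homeos_def)
    then show ?thesis using G tame_homeos_inv[OF p2 G] M[OF that] by (simp add: letter_def)
  qed
  have w: "eval_word q w \<in> tame_homeos p \<and> card (bad_cells p (eval_word q w)) \<le> M * length w
      \<and> card (bad_cells p (inv (eval_word q w))) \<le> M * length w" if "\<forall>l\<in>set w. fst l < q" for w
    using that
  proof (induction w)
    case Nil
    then show ?case
      unfolding eval_word_simps inv_id using tame_homeos_id bad_cells_id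
      by (simp del: id_apply)
  next
    case (Cons a w)
    then have IH: "eval_word q w \<in> tame_homeos p" "card (bad_cells p (eval_word q w)) \<le> M * length w"
      "card (bad_cells p (inv (eval_word q w))) \<le> M * length w" by auto
    have a: "letter q a \<in> tame_homeos p" "card (bad_cells p (letter q a)) \<le> M"
      "card (bad_cells p (inv (letter q a))) \<le> M" using l[of a] Cons.prems by auto
    have "bij (letter q a)" "bij (eval_word q w)"
      using a IH by (auto simp: tame_homeos_def intro: homeo01_bij)
    then have e: "inv (letter q a \<circ> eval_word q w) = inv (eval_word q w) \<circ> inv (letter q a)"
      by (rule o_inv_distrib)
    have "card (bad_cells p (letter q a \<circ> eval_word q w)) \<le> M * length (a # w)"
      using bad_cells_comp(2)[OF p2 a(1) IH(1)] a(2) IH(2) by simp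
    moreover have "card (bad_cells p (inv (letter q a \<circ> eval_word q w))) \<le> M * length (a # w)"
      unfolding e
      using bad_cells_comp(2)[OF p2 tame_homeos_inv[OF p2 IH(1)] tame_homeos_inv[OF p2 a(1)]] a(3) IH(3) by simp
    ultimately show ?case
      unfolding eval_word_simps using bad_cells_comp(1)[OF p2 a(1) IH(1)] by blast
  qed
  have "g \<in> tame_homeos p \<and> card (bad_cells p g) \<le> M * n \<and> card (bad_cells p (inv g)) \<le> M * n"
    if ng: "word_ball q n g" for n g
  proof -
    obtain v where v: "length v \<le> n" "\<forall>l\<in>set v. fst l < q" "eval_word q v = g"
      using ng unfolding word_ball_def by blast
    have "M * length v \<le> M * n" using v(1) by simp
    then show ?thesis using w[OF v(2)] v(3) by (meson order_trans)
  qed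
  then show ?thesis by blast
qed

lemma word_ball_inv:
  assumes q2: "2 \<le> q" and g: "word_ball q n g" shows "word_ball q n (inv g)"
proof -
  have bl: "bij (letter q l)" if "fst l < q" for l
    using homeo01_bij[OF homeo01_xgen[OF q2 that]] by (simp add: letter_def bij_imp_bij_inv)
  have w: "bij (eval_word q w) \<and> word_ball q (length w) (inv (eval_word q w))"
    if "\<forall>l\<in>set w. fst l < q" for w
    using that
  proof (induction w)
    case Nil
    have "eval_word q [] = id" by (rule eval_word_simps)
    moreover have "word_ball q (length []) id" unfolding word_ball_def by (intro exI[of _ "[]"]) simp
    ultimately show ?case by (simp only: inv_id bij_id)
  next
    case (Cons l w)
    then have IH: "bij (eval_word q w)" "word_ball q (length w) (inv (eval_word q w))" and lq: "fst l < q"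
      by auto
    have "inv (letter q l) = letter q (fst l, \<not> snd l)"
      using homeo01_bij[OF homeo01_xgen[OF q2 lq]] by (simp add: letter_def inv_inv_eq)
    then have "word_ball q 1 (inv (letter q l))" using word_ball_letter[OF lq] by metis
    then have "word_ball q (length w + 1) (inv (eval_word q w) \<circ> inv (letter q l))"
      using IH(2) by (rule word_ball_comp[rotated])
    moreover have "length w + 1 = length (l # w)" by simp
    ultimately show ?case
      unfolding eval_word_simps o_inv_distrib[OF bl[OF lq] IH(1)]
      using bij_comp[OF IH(1) bl[OF lq]] by metis
  qed
  obtain v where "length v \<le> n" "\<forall>l\<in>set v. fst l < q" "eval_word q v = g"
    using g unfolding word_ball_def by blast
  then show ?thesis using w word_ball_mono by blast
qed

text \<open>Straighten \<open>f\<close> by \<open>u\<close> to \<open>h\<close>, then the inverse of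
  \<open>h\<close> by \<open>v\<close>. The result is good on all leaves in both directions, hence
  the identity, and \<open>f\<close> is \<open>v\<close> times the inverse of \<open>u\<close>. The
  bad cells of \<open>inv h\<close> are controlled by those of \<open>inv f\<close> and the length
  of \<open>u\<close>.\<close>

lemma word_ball_le_bad_cells:
  assumes q2: "2 \<le> q"
  shows "\<exists>C. \<forall>f\<in>tame_homeos q. word_ball q (C * (card (bad_cells q f) + card (bad_cells q (inv f)))) f"
proof -
  obtain M where M: "\<And>n g. word_ball q n g \<Longrightarrow> card (bad_cells q (inv g)) \<le> M * n"
    and RG: "\<And>n g. word_ball q n g \<Longrightarrow> g \<in> tame_homeos q"
    using word_ball_bad_cells[OF q2 xgen_tame_homeos[OF q2]] by blast
  have "word_ball q ((25 * M + 5) * (card (bad_cells q f) + card (bad_cells q (inv f)))) f"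
    if f: "f \<in> tame_homeos q" for f
  proof -
    define N N' where "N = card (bad_cells q f)" and "N' = card (bad_cells q (inv f))"
    obtain u where u: "homeo01 u" "word_ball q (5 * N) u" "\<forall>j. good q (f \<circ> u) (leaf q j)"
      using straighten[OF q2 f] unfolding N_def by blast
    define h where "h = f \<circ> u"
    have hf: "homeo01 f" using f by (simp add: tame_homeos_def)
    have hh: "homeo01 h" unfolding h_def using hf u(1) by (rule homeo01_comp)
    have uG: "u \<in> tame_homeos q" using RG u(2) by blast
    have hG: "h \<in> tame_homeos q" unfolding h_def by (rule bad_cells_comp(1)[OF q2 f uG])
    have "inv h = inv u \<circ> inv f"
      unfolding h_def using hf u(1) by (intro o_inv_distrib homeo01_bij)
    then have "card (bad_cells q (inv h)) \<le> card (bad_cells q (inv u)) + N'"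
      unfolding N'_def using bad_cells_comp(2)[OF q2 tame_homeos_inv[OF q2 uG] tame_homeos_inv[OF q2 f]] by simp
    also have "\<dots> \<le> M * (5 * N) + N'" using M[OF u(2)] by simp
    finally have N2: "card (bad_cells q (inv h)) \<le> M * (5 * N) + N'" .
    obtain v where v: "homeo01 v" "word_ball q (5 * card (bad_cells q (inv h))) v"
      "\<forall>j. good q (inv h \<circ> v) (leaf q j)"
      "(\<forall>j. good q (inv (inv h)) (leaf q j)) \<longrightarrow> (\<forall>j. good q (inv (inv h \<circ> v)) (leaf q j))"
      using straighten[OF q2 tame_homeos_inv[OF q2 hG]] by blast
    have "inv (inv h) = h" by (rule inv_inv_eq[OF homeo01_bij[OF hh]])
    then have "\<forall>j. good q (inv (inv h \<circ> v)) (leaf q j)" using v(4) u(3) h_def by simp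
    then have "inv h \<circ> v = id"
      using v(3) by (intro good_leaves_imp_id[OF q2 homeo01_comp[OF homeo01_inv[OF hh] v(1)]]) auto
    then have "h \<circ> inv h \<circ> v = h" by (metis comp_assoc comp_id)
    then have "v = h" using homeo01_bij[OF hh] by (metis bij_is_surj surj_iff id_comp)
    then have "f = v \<circ> inv u"
      unfolding h_def using homeo01_bij[OF u(1)] by (metis bij_is_surj surj_iff comp_assoc comp_id)
    moreover have "word_ball q (5 * card (bad_cells q (inv h)) + 5 * N) (v \<circ> inv u)"
      by (rule word_ball_comp[OF v(2) word_ball_inv[OF q2 u(2)]])
    ultimately have "word_ball q (5 * card (bad_cells q (inv h)) + 5 * N) f" by simp
    \<comment> \<open>By \<open>N2\<close> the left side is at most
      \<open>5 * (5 * M * N + N') + 5 * N\<close>.\<close>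
    moreover have "5 * card (bad_cells q (inv h)) + 5 * N \<le> (25 * M + 5) * (N + N')"
      using N2 by (simp add: algebra_simps)
    ultimately show ?thesis unfolding N_def N'_def by (rule word_ball_mono)
  qed
  then show ?thesis by blast
qed

subsection \<open>Change of base\<close>

lemma pt_power: "pt (p ^ k) (a, d) = pt p (a, k * d)"
  by (simp add: pt_def power_mult fun_eq_iff)

lemma tame_homeos_power:
  assumes "f \<in> tame_homeos (p ^ k)" shows "f \<in> tame_homeos p"
proof -
  obtain N where h: "homeo01 f" and N: "\<forall>a<(p ^ k) ^ N. good (p ^ k) f (a, N)"
    using assms unfolding tame_homeos_def by blast
  have "good p f (a, k * N)" if "a < p ^ (k * N)" for a
  proof -
    have "good (p ^ k) f (a, N)" using N that by (simp add: power_mult)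
    then obtain b e where "cell_map (p ^ k) f (a, N) (b, e)" unfolding good_def by auto
    then have "cell_map p f (a, k * N) (b, k * e)" by (simp add: cell_map_def pt_power)
    then show ?thesis unfolding good_def by blast
  qed
  then show ?thesis using h unfolding tame_homeos_def by blast
qed

text \<open>A cell of depth \<open>d\<close> in base \<open>p ^ k\<close> is a cell of depth \<open>k d\<close> in base \<open>p\<close>. If it is good in
  base \<open>p\<close>, its image has depth divisible by \<open>k\<close> because the slope is a power of \<open>p ^ k\<close>,
  so that it is good in base \<open>p ^ k\<close>, too.\<close>
lemma card_bad_cells_power:
  assumes p2: "2 \<le> p" and k1: "1 \<le> k" and f: "f \<in> tame_homeos (p ^ k)"
  shows "card (bad_cells (p ^ k) f) \<le> card (bad_cells p f)"
proof -
  define q where "q = p ^ k"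
  have "p ^ 1 \<le> p ^ k" using p2 k1 by (intro power_increasing) auto
  then have q2: "2 \<le> q" using p2 by (simp add: q_def)
  obtain N where N: "\<forall>a<q ^ N. good q f (a, N)" using f by (auto simp: tame_homeos_def q_def)
  have descend: "good q f (a, d)" if a: "a < q ^ d" and g: "good p f (a, k * d)" for a d
  proof -
    obtain b e where be: "cell_map p f (a, k * d) (b, e)" using g by (auto simp: good_def)
    \<comment> \<open>A deep subcell is good in base \<open>q\<close>, so the length of its image is
      a power of \<open>1 / q\<close>. Computing that length from the affine map on the whole cell
      as well determines \<open>e\<close>.\<close>
    define A where "A = subcell q (a, d) N 0"
    have A: "A = (a * q ^ N, d + N)" by (simp add: A_def subcell_def)
    have "a * q ^ N + 0 < q ^ (d + N)" using subcell_index_less[OF q2 a, of 0 N] q2 by simp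
    then have "good q f A" using good_deeper[OF q2 N, of A] by (simp add: A std_cell_def)
    then obtain b' e' where be': "cell_map q f A (b', e')" by (auto simp: good_def)
    define s where "s = 1 / real q ^ N"
    have s: "s \<in> {0..1}" using q2 by (simp add: s_def)
    have eq: "pt q A 0 = pt p (a, k * d) 0" "pt q A 1 = pt p (a, k * d) s"
      unfolding A_def pt_subcell[OF q2] s_def by (simp_all add: q_def pt_power)
    have "pt q (b', e') 0 = pt p (b, e) 0" "pt q (b', e') 1 = pt p (b, e) s"
      using be be' s eq unfolding cell_map_def by (metis atLeastAtMost_iff order_refl zero_le_one)+
    then have "pt q (b', e') 1 - pt q (b', e') 0 = pt p (b, e) s - pt p (b, e) 0" by simp
    then have "1 / real q ^ e' = s / real p ^ e" by (simp add: pt_def add_divide_distrib)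
    then have "real p ^ e * real q ^ N = real q ^ e'"
      using p2 q2 by (simp add: s_def field_simps)
    then have "real p ^ (e + k * N) = real p ^ (k * e')" by (simp add: q_def power_add power_mult)
    then have "e + k * N = k * e'" using p2 by (subst (asm) power_inject_exp) auto
    then have "e = k * (e' - N)" by (simp add: diff_mult_distrib2)
    then have "cell_map q f (a, d) (b, e' - N)" using be by (simp add: cell_map_def q_def pt_power)
    then show ?thesis unfolding good_def by blast
  qed
  define \<iota> where "\<iota> J = (fst J, k * snd J)" for J :: "nat \<times> nat"
  have "inj_on \<iota> (bad_cells q f)" using k1 by (intro inj_onI) (auto simp: \<iota>_def prod_eq_iff)
  moreover have "\<iota> ` bad_cells q f \<subseteq> bad_cells p f"
  proof
    fix J assume "J \<in> \<iota> ` bad_cells q f"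
    then obtain a d where J: "J = \<iota> (a, d)" "(a, d) \<in> bad_cells q f" by (metis imageE prod.collapse)
    then show "J \<in> bad_cells p f"
      using descend[of a d] by (auto simp: \<iota>_def bad_cells_def std_cell_def q_def power_mult)
  qed
  moreover have "finite (bad_cells p f)" using tame_homeos_power[OF f] by (simp add: tame_homeos_iff[OF p2])
  ultimately show ?thesis unfolding q_def by (rule card_inj_on_le)
qed

subsection \<open>Elements of the group as tame homeomorphisms\<close>

lemma Fgrp_homeo01:
  assumes "f \<in> Fgrp q" shows "homeo01 f"
proof -
  have out: "\<And>t. t \<notin> {0..1} \<Longrightarrow> f t = t" and im: "f ` {0..1} = {0..1}"
    and mono: "strict_mono_on {0..1} f" using assms by (auto simp: Fgrp_def)
  have le: "f x \<le> f y" if "0 \<le> x" "x \<le> y" "y \<le> 1" for x y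
    using that strict_mono_onD[OF mono, of x y] by (cases "x = y") auto
  have rng: "f x \<in> {0..1}" if "x \<in> {0..1}" for x using im that by blast
  obtain s where s: "s \<in> {0..1}" "f s = 0" using im by (metis imageE atLeastAtMost_iff order_refl zero_le_one)
  obtain s' where s': "s' \<in> {0..1}" "f s' = 1" using im by (metis imageE atLeastAtMost_iff order_refl zero_le_one)
  have f0: "f 0 = 0" using le[of 0 s] s rng[of 0] by simp
  have f1: "f 1 = 1" using le[of s' 1] s' rng[of 1] by simp
  have outer: "f t = t" if "t \<le> 0 \<or> 1 \<le> t" for t
    using that f0 f1 out by (cases "t = 0 \<or> t = 1") auto
  have "f x < f y" if "x < y" for x y
  proof -
    consider "x < 0" "y < 0" | "x < 0" "y \<in> {0..1}" | "x < 0" "1 < y" | "x \<in> {0..1}" "y \<in> {0..1}"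
      | "x \<in> {0..1}" "1 < y" | "1 < x" using \<open>x < y\<close> by fastforce
    then show ?thesis
      using \<open>x < y\<close> outer[of x] outer[of y] rng[of x] rng[of y] strict_mono_onD[OF mono, of x y]
      by cases auto
  qed
  then have "strict_mono f" by (rule strict_monoI)
  moreover have "y \<in> range f" for y
  proof (cases "y \<in> {0..1}")
    case True
    then have "y \<in> f ` {0..1}" using im by simp
    then show ?thesis by blast
  next
    case False
    then have "y = f y" using out by simp
    then show ?thesis by (rule range_eqI)
  qed
  then have "surj f" by blast
  ultimately show ?thesis using outer unfolding homeo01_def by blast
qed

lemma Zinv_ev_int:
  assumes "0 < q" "x \<in> Zinv q" shows "ev_int q x"
proof -
  obtain a :: int and n where x: "x = of_int a / real q ^ n" using assms(2) by (auto simp: Zinv_def)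
  have "x * real q ^ N \<in> \<int>" if "n \<le> N" for N
  proof -
    have "real q ^ N = real q ^ n * real q ^ (N - n)" using that by (simp flip: power_add)
    then have "x * real q ^ N = of_int (a * int q ^ (N - n))" using assms(1) by (simp add: x)
    then show ?thesis by (metis Ints_of_int)
  qed
  then show ?thesis unfolding ev_int_def eventually_sequentially by blast
qed

lemma ev_int_add: "ev_int q x \<Longrightarrow> ev_int q y \<Longrightarrow> ev_int q (x + y)"
  and ev_int_diff: "ev_int q x \<Longrightarrow> ev_int q y \<Longrightarrow> ev_int q (x - y)"
  unfolding ev_int_def by (auto elim: eventually_elim2 simp: algebra_simps)

lemma ev_int_powi:
  assumes "0 < q" "ev_int q x" shows "ev_int q (real q powi m * x)"
proof -
  obtain n where n: "\<And>N. n \<le> N \<Longrightarrow> x * real q ^ N \<in> \<int>"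
    using assms(2) unfolding ev_int_def eventually_sequentially by blast
  have "real q powi m * x * real q ^ N \<in> \<int>" if "n + nat \<bar>m\<bar> \<le> N" for N
  proof -
    define M where "M = nat (m + int N)"
    have M: "int M = m + int N" "n \<le> M" using that by (auto simp: M_def)
    have "real q ^ M = real q powi (m + int N)" unfolding M(1)[symmetric] by simp
    also have "\<dots> = real q powi m * real q ^ N" using assms(1) by (simp add: power_int_add)
    finally show ?thesis using n[OF M(2)] by (simp add: algebra_simps)
  qed
  then show ?thesis unfolding ev_int_def eventually_sequentially by blast
qed

text \<open>For large \<open>N\<close> no breakpoint is interior to a cell of depth
  \<open>N\<close>, and a piece of slope \<open>q ^ m\<close> takes such cells to standard cells of
  depth \<open>N - m\<close>.\<close>

lemma Fgrp_subset_tame_homeos: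
  assumes q2: "2 \<le> q" and f: "f \<in> Fgrp q" shows "f \<in> tame_homeos q"
proof -
  have h: "homeo01 f" by (rule Fgrp_homeo01[OF f])
  obtain xs where xs: "xs \<noteq> []" "hd xs = 0" "last xs = 1" "set xs \<subseteq> Zinv q"
    and "\<forall>j. Suc j < length xs \<longrightarrow>
      (\<exists>(m::int) (c::real). \<forall>t\<in>{xs ! j .. xs ! Suc j}. f t = (real q) powi m * t + c)"
    and so: "sorted_wrt (<) xs"
    using f unfolding Fgrp_def by blast
  then obtain m :: "nat \<Rightarrow> int" and c :: "nat \<Rightarrow> real" where
    mc: "\<And>j t. Suc j < length xs \<Longrightarrow> xs ! j \<le> t \<Longrightarrow> t \<le> xs ! Suc j \<Longrightarrow> f t = real q powi m j * t + c j"
    by (metis atLeastAtMost_iff)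
  have q0: "0 < q" using q2 by simp
  have inc: "xs ! j \<le> xs ! Suc j" if "Suc j < length xs" for j
    using so that by (simp add: sorted_wrt_iff_nth_less less_imp_le)
  have xe: "ev_int q (xs ! j)" if "j < length xs" for j
    using Zinv_ev_int[OF q0] xs(4) that by (meson nth_mem subsetD)
  have fe: "ev_int q (f (xs ! j))" if "j < length xs" for j
    using that
  proof (induction j)
    case 0
    then have "f (xs ! 0) = 0" using xs(1,2) h by (simp add: hd_conv_nth homeo01_def)
    then show ?case by (simp add: ev_int_def)
  next
    case (Suc j)
    then have "f (xs ! Suc j) = f (xs ! j) + real q powi m j * (xs ! Suc j - xs ! j)"
      using mc[of j "xs ! j"] mc[of j "xs ! Suc j"] inc[of j] by (simp add: algebra_simps)
    moreover have "ev_int q (real q powi m j * (xs ! Suc j - xs ! j))"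
      using Suc.prems by (intro ev_int_powi[OF q0] ev_int_diff xe) auto
    ultimately show ?case using Suc by (simp add: ev_int_add)
  qed
  \<comment> \<open>On a piece the map is \<open>q ^ m * (t + q ^ (- m) * c)\<close>; this offset,
    times \<open>q ^ N\<close>, is the shift of the index of a cell.\<close>
  have ce: "ev_int q (real q powi (- m j) * c j)" if "Suc j < length xs" for j
  proof -
    have "c j = f (xs ! j) - real q powi m j * xs ! j" using mc[OF that, of "xs ! j"] inc[OF that] by simp
    moreover have "ev_int q (f (xs ! j) - real q powi m j * xs ! j)"
      using that by (intro ev_int_diff ev_int_powi[OF q0] fe xe) auto
    ultimately show ?thesis using ev_int_powi[OF q0] by simp
  qed
  have "\<forall>\<^sub>F N in sequentially. \<forall>j\<in>{..<length xs}. xs ! j * real q ^ N \<in> \<int>"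
    using xe by (intro eventually_ball_finite) (auto simp: ev_int_def)
  moreover have "\<forall>\<^sub>F N in sequentially. \<forall>j\<in>{j. Suc j < length xs}. real q powi (- m j) * c j * real q ^ N \<in> \<int>"
    using ce by (intro eventually_ball_finite) (auto simp: ev_int_def intro: finite_subset[of _ "{..<length xs}"])
  moreover have "\<forall>\<^sub>F N in sequentially. \<forall>j\<in>{..<length xs}. nat (m j) \<le> N"
    by (intro eventually_ball_finite) (auto intro: eventually_ge_at_top)
  ultimately have "\<forall>\<^sub>F N in sequentially. (\<forall>j\<in>{..<length xs}. xs ! j * real q ^ N \<in> \<int>)
      \<and> (\<forall>j\<in>{j. Suc j < length xs}. real q powi (- m j) * c j * real q ^ N \<in> \<int>)
      \<and> (\<forall>j\<in>{..<length xs}. nat (m j) \<le> N)"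
    by (intro eventually_conj)
  then obtain N where "(\<forall>j\<in>{..<length xs}. xs ! j * real q ^ N \<in> \<int>)
      \<and> (\<forall>j\<in>{j. Suc j < length xs}. real q powi (- m j) * c j * real q ^ N \<in> \<int>)
      \<and> (\<forall>j\<in>{..<length xs}. nat (m j) \<le> N)"
    unfolding eventually_sequentially by blast
  then have N1: "\<And>j. j < length xs \<Longrightarrow> xs ! j * real q ^ N \<in> \<int>"
    and N2: "\<And>j. Suc j < length xs \<Longrightarrow> real q powi (- m j) * c j * real q ^ N \<in> \<int>"
    and N3: "\<And>j. j < length xs \<Longrightarrow> nat (m j) \<le> N"
    by simp_all
  have qN: "0 < real q ^ N" using q0 by simp
  have "good q f (a, N)" if a: "a < q ^ N" for a
  proof -
    define x where "x = real a / real q ^ N"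
    have x0: "0 \<le> x" by (simp add: x_def)
    have "real a < real (q ^ N)" using a by (simp only: of_nat_less_iff)
    then have x1: "x < 1" using qN by (simp add: x_def)
    \<comment> \<open>The first breakpoint beyond \<open>x\<close> is not \<open>xs ! 0\<close>,
      which is 0, so some piece ends there.\<close>
    let ?P = "\<lambda>i. i < length xs \<and> x < xs ! i"
    have "?P (length xs - 1)" using xs(1,3) x1 by (simp add: last_conv_nth)
    then have P: "?P (LEAST i. ?P i)" by (rule LeastI)
    have "xs ! 0 = 0" using xs(1,2) by (simp add: hd_conv_nth)
    then have "(LEAST i. ?P i) \<noteq> 0" using P x0 by (metis not_le)
    then obtain j where j: "(LEAST i. ?P i) = Suc j" using not0_implies_Suc by blast
    have jl: "Suc j < length xs" and xj: "x < xs ! Suc j" using P unfolding j by auto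
    have "\<not> ?P j" by (rule not_less_Least) (simp add: j)
    then have xj': "xs ! j \<le> x" using jl by simp
    \<comment> \<open>A breakpoint beyond the left end of the cell is a multiple of
      \<open>1 / q ^ N\<close>, so it does not come before the right end.\<close>
    obtain z where z: "xs ! Suc j * real q ^ N = of_int z" using N1[OF jl] by (auto elim: Ints_cases)
    have "real a < of_int z" using xj qN unfolding z[symmetric] by (simp add: x_def field_simps)
    then have "int a < z" by linarith
    then have "real a + 1 \<le> of_int z" by linarith
    then have top: "(real a + 1) / real q ^ N \<le> xs ! Suc j"
      using qN unfolding z[symmetric] by (simp add: field_simps)
    obtain B where B: "real q powi (- m j) * c j * real q ^ N = of_int B"
      using N2[OF jl] by (auto elim: Ints_cases)
    define e where "e = nat (int N - m j)"
    have "m j \<le> int N" using N3[of j] jl by linarith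
    then have e: "int e = int N - m j" by (simp add: e_def)
    have Qe: "real q ^ e = real q ^ N * real q powi (- m j)"
    proof -
      have "real q ^ e = real q powi (int N + (- m j))" using e by (simp flip: power_int_of_nat)
      also have "\<dots> = real q powi int N * real q powi (- m j)"
        using q0 by (intro power_int_add) simp
      finally show ?thesis by simp
    qed
    have cB: "c j * real q ^ e = of_int B" unfolding Qe B[symmetric] by (simp add: algebra_simps)
    have mQ: "real q powi m j * real q ^ e = real q ^ N"
      unfolding Qe using q0 by (simp add: power_int_minus)
    have ft: "f (pt q (a, N) t) = (real a + of_int B + t) / real q ^ e" if t: "t \<in> {0..1}" for t
    proof -
      have "x \<le> pt q (a, N) t" "pt q (a, N) t \<le> (real a + 1) / real q ^ N"
        using t qN by (auto simp: x_def pt_def divide_right_mono)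
      then have "f (pt q (a, N) t) = real q powi m j * pt q (a, N) t + c j"
        using xj' top by (intro mc[OF jl]) auto
      also have "\<dots> * real q ^ e = (real q powi m j * real q ^ e) * pt q (a, N) t + c j * real q ^ e"
        by (simp add: algebra_simps)
      also have "\<dots> = real a + t + of_int B" unfolding mQ cB using qN by (simp add: pt_def)
      finally show ?thesis using q0 by (simp add: field_simps)
    qed
    \<comment> \<open>The index of the image cell must be a natural number; it is not negative
      because \<open>f\<close> is not.\<close>
    have "0 \<le> f (pt q (a, N) 0)" by (rule homeo01_ge_0[OF h]) (simp add: pt_def)
    then have "0 \<le> (real a + of_int B) / real q ^ e" using ft[of 0] by simp
    then have "0 \<le> (real a + of_int B) / real q ^ e * real q ^ e"
      by (rule mult_nonneg_nonneg) simp
    then have "0 \<le> real a + of_int B" using q0 by simp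
    then have "0 \<le> int a + B" by linarith
    then have b: "real (nat (int a + B)) = real a + of_int B" by simp
    have "cell_map q f (a, N) (nat (int a + B), e)"
      unfolding cell_map_def using ft b by (simp add: pt_def)
    then show ?thesis unfolding good_def by blast
  qed
  then show ?thesis using h unfolding tame_homeos_def by blast
qed

section \<open>Comparison of the two word metrics\<close>

theorem theorem7:
  fixes p k :: nat
  assumes "p \<ge> 2" and "k \<ge> 1"
  shows "\<exists>C K. C \<ge> 1 \<and> K \<ge> 0 \<and>
    (\<forall>a\<in>Fgrp (p ^ k). \<forall>b\<in>Fgrp (p ^ k).
       word_dist (p ^ k) a b / C - K \<le> word_dist p a b \<and>
       word_dist p a b \<le> C * word_dist (p ^ k) a b + K)"
proof -
  define q where "q = p ^ k"
  have "p ^ 1 \<le> p ^ k" using assms by (intro power_increasing) auto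
  then have q2: "2 \<le> q" using assms by (simp add: q_def)
  obtain Cp where Cp: "\<And>f. f \<in> tame_homeos p \<Longrightarrow>
      word_ball p (Cp * (card (bad_cells p f) + card (bad_cells p (inv f)))) f"
    using word_ball_le_bad_cells[OF assms(1)] by blast
  obtain Cq where Cq: "\<And>f. f \<in> tame_homeos q \<Longrightarrow>
      word_ball q (Cq * (card (bad_cells q f) + card (bad_cells q (inv f)))) f"
    using word_ball_le_bad_cells[OF q2] by blast
  obtain Mp where Mp: "\<And>n g. word_ball p n g \<Longrightarrow>
      card (bad_cells p g) \<le> Mp * n \<and> card (bad_cells p (inv g)) \<le> Mp * n"
    using word_ball_bad_cells[OF assms(1) xgen_tame_homeos[OF assms(1)]] by blast
  \<comment> \<open>This lets \<open>Mq\<close> bound bad cells in base \<open>p\<close> by the word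
    length in F(p^k).\<close>
  have "xgen q i \<in> tame_homeos p" if "i < q" for i
    using xgen_tame_homeos[OF q2 that] tame_homeos_power unfolding q_def by blast
  then obtain Mq where Mq: "\<And>n g. word_ball q n g \<Longrightarrow>
      card (bad_cells p g) \<le> Mq * n \<and> card (bad_cells p (inv g)) \<le> Mq * n"
    using word_ball_bad_cells[OF assms(1)] by metis
  \<comment> \<open>The summand 1 makes the constant at least 1; the factors 2 come from counting
    bad cells of both \<open>g\<close> and its inverse.\<close>
  define D where "D = 1 + 2 * Cp * Mq + 2 * Cq * Mp"
  have main: "word_length p g \<le> D * word_length q g \<and> word_length q g \<le> D * word_length p g"
    if gq: "g \<in> tame_homeos q" for g
  proof
    have gp: "g \<in> tame_homeos p" using gq tame_homeos_power unfolding q_def by blast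
    have iq: "inv g \<in> tame_homeos q" by (rule tame_homeos_inv[OF q2 gq])
    note rp = word_length_word_ball[OF Cp[OF gp]] and rq = word_length_word_ball[OF Cq[OF gq]]
    have "word_length p g \<le> Cp * (card (bad_cells p g) + card (bad_cells p (inv g)))" by (rule rp(2))
    also have "\<dots> \<le> Cp * (Mq * word_length q g + Mq * word_length q g)"
      using Mq[OF rq(1)] by (intro mult_left_mono add_mono) auto
    also have "\<dots> \<le> D * word_length q g" by (simp add: D_def algebra_simps)
    finally show "word_length p g \<le> D * word_length q g" .
    have "word_length q g \<le> Cq * (card (bad_cells q g) + card (bad_cells q (inv g)))" by (rule rq(2))
    also have "\<dots> \<le> Cq * (card (bad_cells p g) + card (bad_cells p (inv g)))"
      using card_bad_cells_power[OF assms gq[unfolded q_def]]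
        card_bad_cells_power[OF assms iq[unfolded q_def]]
      by (intro mult_left_mono add_mono) (auto simp: q_def)
    also have "\<dots> \<le> Cq * (Mp * word_length p g + Mp * word_length p g)"
      using Mp[OF rp(1)] by (intro mult_left_mono add_mono) auto
    also have "\<dots> \<le> D * word_length p g" by (simp add: D_def algebra_simps)
    finally show "word_length q g \<le> D * word_length p g" .
  qed
  have D1: "1 \<le> real D" by (simp add: D_def)
  \<comment> \<open>The additive constant is 0, so the inclusion is even bi-Lipschitz.\<close>
  have "word_dist q a b / real D - 0 \<le> word_dist p a b \<and>
      word_dist p a b \<le> real D * word_dist q a b + 0" if "a \<in> Fgrp q" "b \<in> Fgrp q" for a b
  proof -
    have "inv a \<circ> b \<in> tame_homeos q"
      using that Fgrp_subset_tame_homeos[OF q2] tame_homeos_inv[OF q2] bad_cells_comp(1)[OF q2] by blast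
    then have "word_length p (inv a \<circ> b) \<le> D * word_length q (inv a \<circ> b)"
      "word_length q (inv a \<circ> b) \<le> D * word_length p (inv a \<circ> b)" using main by blast+
    then have "word_dist p a b \<le> real D * word_dist q a b" "word_dist q a b \<le> real D * word_dist p a b"
      unfolding word_dist_def by (metis of_nat_le_iff of_nat_mult)+
    then show ?thesis using D1 by (simp add: divide_le_eq mult.commute)
  qed
  then have "\<exists>C K. C \<ge> 1 \<and> K \<ge> 0 \<and> (\<forall>a\<in>Fgrp q. \<forall>b\<in>Fgrp q.
      word_dist q a b / C - K \<le> word_dist p a b \<and> word_dist p a b \<le> C * word_dist q a b + K)"
    using D1 order_refl[of "0::real"] by blast
  then show ?thesis unfolding q_def .
qed

end
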